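(* Let $\{S_i\}_{i=1}^m$ be an SS-IFS in $\mathbb{R}^d$ with attractor $K\subseteq\mathbb{R}^d$ containing at least two points, let $t=\dim_H(K)$, let $L:\mathbb{R}^d\to\mathbb{R}^{d_2}$ be a linear map, and let $A,B\subseteq K$ be such that $\mathcal{H}^t(A\cap B)=0$ and $A$ is $\mathcal{H}^t$-measurable. Then $\mathcal{H}^t\left(L(A)\cap L(B)\right)=0$.
   Context: $\dim_H$ denotes Hausdorff dimension and $\mathcal{H}^t$ denotes $t$-dimensional Hausdorff (outer) measure; a set is $\mathcal{H}^t$-measurable if it is Carathéodory measurable for $\mathcal{H}^t$. A self-similar iterated function system (SS-IFS) in $\mathbb{R}^d$ is a finite collection $\{S_i\}_{i=1}^m$ of contracting similarities of $\mathbb{R}^d$. Its attractor is the unique nonempty compact $K$ with $K=\bigcup_{i=1}^m S_i(K)$. No separation condition is assumed. *)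

theory Defs
  imports "HOL-Analysis.Analysis"
begin

(* diam(U)^s with the usual conventions diam({})^s = 0 and diam(U)^0 = 1 for nonempty U;
   they are spelled out because 0 powr 0 = 0. *)
definition diam_pow :: "real \<Rightarrow> 'a::metric_space set \<Rightarrow> ennreal" where
  "diam_pow s U = (if U = {} then 0 else if s = 0 then 1 else ennreal (diameter U powr s))"

(* Boundedness is required since diameter is unspecified on unbounded sets.
   Finite covers are included, padded by empty sets. *)
definition hausdorff_premeasure :: "real \<Rightarrow> real \<Rightarrow> 'a::metric_space set \<Rightarrow> ennreal" where
  "hausdorff_premeasure s \<delta> A =
     (INF U \<in> {U :: nat \<Rightarrow> 'a set.
                A \<subseteq> (\<Union>i. U i) \<and> (\<forall>i. bounded (U i) \<and> diameter (U i) \<le> \<delta>)}.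
        \<Sum>i. diam_pow s (U i))"

(* Defined on all subsets and without a normalising constant, which affects neither
   null sets nor measurability. *)
definition hausdorff_measure :: "real \<Rightarrow> 'a::metric_space set \<Rightarrow> ennreal" where
  "hausdorff_measure s A = (SUP \<delta> \<in> {0<..}. hausdorff_premeasure s \<delta> A)"

(* The infimum is over a nonempty set: in a Euclidean space the s-dimensional measure
   vanishes for every s > DIM('a). *)
definition hausdorff_dim :: "'a::euclidean_space set \<Rightarrow> real" where
  "hausdorff_dim A = Inf {s. 0 \<le> s \<and> hausdorff_measure s A = 0}"

definition hausdorff_measurable :: "real \<Rightarrow> 'a::metric_space set \<Rightarrow> bool" where
  "hausdorff_measurable s A \<longleftrightarrow> A \<in> lambda_system UNIV (Pow UNIV) (hausdorff_measure s)"

definition contracting_similarity :: "('a::metric_space \<Rightarrow> 'a) \<Rightarrow> bool" where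
  "contracting_similarity f \<longleftrightarrow> (\<exists>r. 0 < r \<and> r < 1 \<and> (\<forall>x y. dist (f x) (f y) = r * dist x y))"

definition ss_ifs :: "nat \<Rightarrow> (nat \<Rightarrow> 'a::metric_space \<Rightarrow> 'a) \<Rightarrow> bool" where
  "ss_ifs m S \<longleftrightarrow> (\<forall>i\<in>{1..m}. contracting_similarity (S i))"

definition is_attractor :: "nat \<Rightarrow> (nat \<Rightarrow> 'a::metric_space \<Rightarrow> 'a) \<Rightarrow> 'a set \<Rightarrow> bool" where
  "is_attractor m S K \<longleftrightarrow> K \<noteq> {} \<and> compact K \<and> K = (\<Union>i\<in>{1..m}. S i ` K)"

end

theory Submission
  imports Defs
begin

text \<open>Write \<open>r\<^sub>w\<close> for the contraction ratio and \<open>O\<^sub>w\<close> for the orthogonal part of the map of a word \<open>w\<close>.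

  If finitely many cylinders are pairwise disjoint then \<open>\<Sum> r\<^sub>w\<^sup>t \<le> 1\<close>, since otherwise they would generate
  a subset of \<open>K\<close> of dimension larger than \<open>t\<close>. Let \<open>\<lambda>(V)\<close> be the supremum of these sums over
  disjoint cylinders inside a relatively open \<open>V \<subseteq> K\<close>. Vitali's covering lemma gives
  \<open>\<H>\<^sup>t(V) \<le> C \<lambda>(V)\<close>, and as \<open>\<lambda>\<close> is superadditive, finitely many disjoint cylinders fill \<open>V\<close> up to
  arbitrarily small measure.

  Let \<open>h(T)\<close> be the Hausdorff content of \<open>T(K)\<close> for linear \<open>T\<close>. Filling \<open>K\<close> by cylinders shows that
  \<open>h(T) \<le> \<Sum> r\<^sub>w\<^sup>t h(T O\<^sub>w)\<close> up to a small error, so a point where the upper semicontinuous function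
  \<open>P \<mapsto> h(T P)\<close> is maximal on the closure of all \<open>O\<^sub>w\<close> propagates to the identity: \<open>h(T O\<^sub>w) \<le> h(T)\<close>.
  Hence the content of \<open>T(V)\<close> equals \<open>h(T) \<lambda>(V)\<close> for all relatively open \<open>V\<close>; for \<open>T = id\<close> this
  also bounds \<open>\<H>\<^sup>t(V)\<close>.

  Finally let \<open>A\<close>, \<open>B\<close> be disjoint and \<open>E = L(A) \<inter> L(B)\<close>. Both \<open>A \<inter> L\<^sup>-\<^sup>1(E)\<close> and \<open>B \<inter> L\<^sup>-\<^sup>1(E)\<close> have image \<open>E\<close>,
  and by measurability of \<open>A\<close> their measures add up, to at most the measure of \<open>K \<inter> L\<^sup>-\<^sup>1(E)\<close>. Up to
  constants this says that twice the content of \<open>E\<close> is at most the content of \<open>E\<close>.\<close>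

section \<open>Hausdorff content\<close>

text \<open>The condition \<open>P\<close> on the covering sets lets Hausdorff content
  (\<open>P = bounded\<close>) and the premeasure of mesh \<open>\<delta>\<close> share one set of
  rules for monotonicity and subadditivity.\<close>

definition cover_content :: "('a::metric_space set \<Rightarrow> bool) \<Rightarrow> real \<Rightarrow> 'a set \<Rightarrow> ennreal" where
  "cover_content P s A =
     (INF U \<in> {U :: nat \<Rightarrow> 'a set. A \<subseteq> (\<Union>i. U i) \<and> (\<forall>i. P (U i))}. \<Sum>i. diam_pow s (U i))"

abbreviation hausdorff_content :: "real \<Rightarrow> 'a::metric_space set \<Rightarrow> ennreal" where
  "hausdorff_content \<equiv> cover_content bounded"

lemma hausdorff_premeasure_eq_cover_content:
  "hausdorff_premeasure s \<delta> = cover_content (\<lambda>U. bounded U \<and> diameter U \<le> \<delta>) s"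
  by (auto simp: fun_eq_iff hausdorff_premeasure_def cover_content_def)

lemma diam_pow_empty [simp]: "diam_pow s {} = 0"
  by (simp add: diam_pow_def)

lemma diam_pow_pos: "s > 0 \<Longrightarrow> diam_pow s U = ennreal (diameter U powr s)"
  by (simp add: diam_pow_def)

lemma cover_content_mono: "A \<subseteq> B \<Longrightarrow> cover_content P s A \<le> cover_content P s B"
  unfolding cover_content_def by (rule INF_superset_mono) auto

lemma cover_content_antimono:
  "(\<And>U. P U \<Longrightarrow> Q U) \<Longrightarrow> cover_content Q s A \<le> cover_content P s A"
  unfolding cover_content_def by (rule INF_superset_mono) auto

lemma cover_content_le:
  "A \<subseteq> (\<Union>i. U i) \<Longrightarrow> (\<And>i. P (U i)) \<Longrightarrow> cover_content P s A \<le> (\<Sum>i. diam_pow s (U i))"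
  unfolding cover_content_def by (rule INF_lower) auto

lemma cover_content_lessE:
  assumes "cover_content P s A < a"
  obtains U :: "nat \<Rightarrow> 'a::metric_space set"
  where "A \<subseteq> (\<Union>i. U i)" "\<And>i. P (U i)" "(\<Sum>i. diam_pow s (U i)) < a"
  using assms unfolding cover_content_def INF_less_iff by auto

lemma cover_content_empty: "P {} \<Longrightarrow> cover_content P s {} = 0"
  using cover_content_le[of "{}" "\<lambda>_. {}" P s] by simp

text \<open>Covers by balls from Vitali's lemma or by cylinders carry their own index set, which is
  enumerated here. The bound concerns finite subfamilies because packings are finite.\<close>

lemma cover_content_le_countable:
  assumes C: "countable C" and cov: "A \<subseteq> (\<Union>i\<in>C. U i)" and P: "\<And>i. i \<in> C \<Longrightarrow> P (U i)" "P {}"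
    and b: "\<And>F. finite F \<Longrightarrow> F \<subseteq> C \<Longrightarrow> (\<Sum>i\<in>F. diam_pow s (U i)) \<le> b"
  shows "cover_content P s A \<le> b"
proof -
  define I where "I = to_nat_on C ` C"
  define V where "V n = (if n \<in> I then U (from_nat_into C n) else {})" for n
  have inj: "from_nat_into C n \<in> C" "to_nat_on C (from_nat_into C n) = n" if "n \<in> I" for n
    using that C by (auto simp: I_def)
  have "U c \<subseteq> V (to_nat_on C c)" if "c \<in> C" for c
    using that C by (auto simp: V_def I_def)
  then have "(\<Union>c\<in>C. U c) \<subseteq> (\<Union>i. V i)"
    by blast
  with cov have "A \<subseteq> (\<Union>i. V i)"
    by (rule subset_trans)
  moreover have "P (V n)" for n
    using inj P by (auto simp: V_def)
  ultimately have "cover_content P s A \<le> (\<Sum>n. diam_pow s (V n))"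
    by (rule cover_content_le)
  also have "\<dots> \<le> b"
  proof (rule suminf_le_const)
    fix n
    have inj_on: "inj_on (from_nat_into C) ({..<n} \<inter> I)"
      by (rule inj_on_inverseI[where g = "to_nat_on C"]) (use inj in auto)
    have "(\<Sum>i<n. diam_pow s (V i)) = (\<Sum>i\<in>{..<n} \<inter> I. diam_pow s (V i))"
      by (rule sum.mono_neutral_right) (auto simp: V_def)
    also have "\<dots> = (\<Sum>i\<in>{..<n} \<inter> I. diam_pow s (U (from_nat_into C i)))"
      by (rule sum.cong) (auto simp: V_def)
    also have "\<dots> = (\<Sum>c\<in>from_nat_into C ` ({..<n} \<inter> I). diam_pow s (U c))"
      using inj_on by (simp add: sum.reindex)
    also have "\<dots> \<le> b"
      by (rule b) (use inj in auto)
    finally show "(\<Sum>i<n. diam_pow s (V i)) \<le> b" .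
  qed auto
  finally show ?thesis .
qed

lemma cover_content_UN_le:
  fixes A :: "nat \<Rightarrow> 'a::metric_space set"
  shows "cover_content P s (\<Union>i. A i) \<le> (\<Sum>i. cover_content P s (A i))"
proof (rule ennreal_le_epsilon)
  fix e :: real
  assume fin: "(\<Sum>i. cover_content P s (A i)) < top" and e: "e > 0"
  have "\<forall>n. \<exists>U. A n \<subseteq> (\<Union>i. U i) \<and> (\<forall>i. P (U i)) \<and>
    (\<Sum>i. diam_pow s (U i)) < cover_content P s (A n) + ennreal (e * (1/2) ^ Suc n)"
  proof
    fix n
    have "cover_content P s (A n) < top"
      using fin by (rule ennreal_suminf_lessD)
    then have "cover_content P s (A n) < cover_content P s (A n) + ennreal (e * (1/2) ^ Suc n)"
      using e ennreal_add_left_cancel_less[of "cover_content P s (A n)" 0]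
      by (auto simp: ennreal_zero_less_mult_iff)
    then show "\<exists>U. A n \<subseteq> (\<Union>i. U i) \<and> (\<forall>i. P (U i)) \<and>
        (\<Sum>i. diam_pow s (U i)) < cover_content P s (A n) + ennreal (e * (1/2) ^ Suc n)"
      by (rule cover_content_lessE) blast
  qed
  from choice[OF this] obtain U where U: "\<And>n. A n \<subseteq> (\<Union>i. U n i)" "\<And>n i. P (U n i)"
    "\<And>n. (\<Sum>i. diam_pow s (U n i)) < cover_content P s (A n) + ennreal (e * (1/2) ^ Suc n)"
    by blast
  define V where "V k = case_prod U (prod_decode k)" for k
  have "U n i = V (prod_encode (n, i))" for n i
    by (simp add: V_def)
  then have "(\<Union>i. U n i) \<subseteq> (\<Union>k. V k)" for n
    by blast
  with U(1) have "(\<Union>i. A i) \<subseteq> (\<Union>k. V k)"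
    by (meson UN_least subset_trans)
  then have "cover_content P s (\<Union>i. A i) \<le> (\<Sum>k. diam_pow s (V k))"
    by (rule cover_content_le) (auto simp: V_def U split: prod.split)
  also have "\<dots> = (\<Sum>n. \<Sum>i. diam_pow s (U n i))"
    unfolding V_def
    using suminf_ennreal_2dimen[where f = "\<lambda>p. diam_pow s (case_prod U p)"] by simp
  also have "\<dots> \<le> (\<Sum>n. cover_content P s (A n) + ennreal (e * (1/2) ^ Suc n))"
    by (intro suminf_le less_imp_le U(3)) auto
  also have "\<dots> = (\<Sum>n. cover_content P s (A n)) + (\<Sum>n. ennreal (e * (1/2) ^ Suc n))"
    by (rule suminf_add[symmetric]) auto
  also have "(\<Sum>n. ennreal (e * (1/2) ^ Suc n)) = ennreal e"
    using sums_mult[OF power_half_series, of e] e by (intro suminf_ennreal_eq) auto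
  finally show "cover_content P s (\<Union>i. A i) \<le> (\<Sum>n. cover_content P s (A n)) + ennreal e" .
qed

lemma cover_content_Un_le:
  assumes "P {}"
  shows "cover_content P s (A \<union> B) \<le> cover_content P s A + cover_content P s B"
  using cover_content_UN_le[of P s "binaryset A B"] assms
  by (simp add: UN_binaryset_eq suminf_binaryset_eq cover_content_empty)

lemma cover_content_UN_finite_le:
  assumes "P {}" and "finite F"
  shows "cover_content P s (\<Union>i\<in>F. A i) \<le> (\<Sum>i\<in>F. cover_content P s (A i))"
  using assms(2)
proof (induction F)
  case (insert i F)
  have "cover_content P s (\<Union>i\<in>insert i F. A i)
        \<le> cover_content P s (A i) + cover_content P s (\<Union>i\<in>F. A i)"
    using cover_content_Un_le[of P s, OF assms(1)] by simp
  with insert show ?case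
    by (simp add: add_left_mono order_trans)
qed (simp add: cover_content_empty assms)

section \<open>Comparison of content and Hausdorff measure\<close>

lemma hausdorff_premeasure_le_measure:
  "\<delta> > 0 \<Longrightarrow> hausdorff_premeasure s \<delta> A \<le> hausdorff_measure s A"
  unfolding hausdorff_measure_def by (rule SUP_upper) auto

lemma hausdorff_measure_leI:
  "(\<And>\<delta>. \<delta> > 0 \<Longrightarrow> hausdorff_premeasure s \<delta> A \<le> b) \<Longrightarrow> hausdorff_measure s A \<le> b"
  unfolding hausdorff_measure_def by (rule SUP_least) auto

lemma hausdorff_content_le_measure: "hausdorff_content s A \<le> hausdorff_measure s A"
proof -
  have "hausdorff_content s A \<le> hausdorff_premeasure s 1 A"
    unfolding hausdorff_premeasure_eq_cover_content by (rule cover_content_antimono) auto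
  also have "\<dots> \<le> hausdorff_measure s A"
    by (rule hausdorff_premeasure_le_measure) auto
  finally show ?thesis .
qed

lemma hausdorff_measure_mono: "A \<subseteq> B \<Longrightarrow> hausdorff_measure s A \<le> hausdorff_measure s B"
  unfolding hausdorff_measure_def hausdorff_premeasure_eq_cover_content
  by (intro SUP_mono) (auto intro: cover_content_mono)

text \<open>In a cover of total below \<open>\<delta> powr s\<close> every single member has
  diameter at most \<open>\<delta>\<close>, so cheap covers are automatically fine.\<close>

lemma hausdorff_content_eq_0_imp_measure:
  assumes "hausdorff_content s A = 0" and s: "s > 0"
  shows "hausdorff_measure s A = 0"
proof -
  have "hausdorff_premeasure s \<delta> A \<le> 0 + ennreal e" if "\<delta> > 0" "e > 0" for \<delta> e :: real
  proof -
    have "hausdorff_content s A < min (ennreal e) (ennreal (\<delta> powr s))"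
      using assms that by simp
    then obtain U where U: "A \<subseteq> (\<Union>i. U i)" "\<And>i. bounded (U i)"
        "(\<Sum>i. diam_pow s (U i)) < min (ennreal e) (ennreal (\<delta> powr s))"
      by (rule cover_content_lessE) blast
    have "diameter (U i) \<le> \<delta>" for i
    proof -
      have "diam_pow s (U i) < ennreal (\<delta> powr s)"
        using U(3) ennreal_suminf_lessD by auto
      then have "diameter (U i) powr s < \<delta> powr s"
        using s by (simp add: diam_pow_pos ennreal_less_iff)
      then show ?thesis
        using s \<open>\<delta> > 0\<close> by (meson not_le powr_mono2 less_imp_le)
    qed
    then have "hausdorff_premeasure s \<delta> A \<le> (\<Sum>i. diam_pow s (U i))"
      unfolding hausdorff_premeasure_eq_cover_content using U by (intro cover_content_le) auto
    also have "\<dots> \<le> ennreal e"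
      using U(3) by (simp add: less_imp_le)
    finally show ?thesis by simp
  qed
  then have "hausdorff_measure s A \<le> 0"
    by (intro hausdorff_measure_leI, rule ennreal_le_epsilon) simp
  then show ?thesis by simp
qed

section \<open>Lipschitz images\<close>

lemma diameter_image_le:
  assumes "bounded U" and lip: "\<And>x y. x \<in> U \<Longrightarrow> y \<in> U \<Longrightarrow> dist (f x) (f y) \<le> c * dist x y" and "c \<ge> 0"
  shows "bounded (f ` U)" "diameter (f ` U) \<le> c * diameter U"
proof -
  have le: "dist (f x) (f y) \<le> c * diameter U" if "x \<in> U" "y \<in> U" for x y
    using lip[OF that] diameter_bounded_bound[OF assms(1) that] \<open>c \<ge> 0\<close>
    by (meson mult_left_mono order_trans)
  show "bounded (f ` U)"
  proof (cases "U = {}")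
    case False
    then obtain x where "x \<in> U" by auto
    with le show ?thesis
      unfolding bounded_def by blast
  qed auto
  show "diameter (f ` U) \<le> c * diameter U"
    unfolding diameter_def[of "f ` U"]
    using le diameter_ge_0[OF assms(1)] \<open>c \<ge> 0\<close> by (auto intro!: cSUP_least)
qed

lemma le_mult_INF_ennreal:
  fixes k :: ennreal
  assumes "\<And>i. i \<in> I \<Longrightarrow> a \<le> k * f i" "k \<noteq> 0" "k \<noteq> top"
  shows "a \<le> k * (INF i\<in>I. f i)"
proof -
  have "a / k \<le> (INF i\<in>I. f i)"
    using assms by (intro INF_greatest divide_le_posI_ennreal) (auto simp: zero_less_iff_neq_zero)
  then have "k * (a / k) \<le> k * (INF i\<in>I. f i)"
    by (rule mult_left_mono) simp
  then show ?thesis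
    using assms by (simp add: ennreal_times_divide mult_divide_eq_ennreal mult.commute)
qed

text \<open>The covering sets are cut down to \<open>A\<close>, where the Lipschitz bound is
  assumed. \<open>P\<close> and \<open>Q\<close> may differ because a strong contraction turns a
  cover by bounded sets into one by small sets.\<close>

lemma cover_content_image_le:
  assumes lip: "\<And>x y. x \<in> A \<Longrightarrow> y \<in> A \<Longrightarrow> dist (f x) (f y) \<le> c * dist x y"
    and "c > 0" "s > 0"
    and P: "\<And>U. P U \<Longrightarrow> bounded U" and Q: "\<And>U. P U \<Longrightarrow> Q (f ` (U \<inter> A))"
  shows "cover_content Q s (f ` A) \<le> ennreal (c powr s) * cover_content P s A"
  unfolding cover_content_def[of P]
proof (rule le_mult_INF_ennreal)
  fix U assume "U \<in> {U :: nat \<Rightarrow> _. A \<subseteq> (\<Union>i. U i) \<and> (\<forall>i. P (U i))}"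
  then have U: "A \<subseteq> (\<Union>i. U i)" "\<And>i. P (U i)"
    by auto
  have "cover_content Q s (f ` A) \<le> (\<Sum>i. diam_pow s (f ` (U i \<inter> A)))"
    using U(1) by (intro cover_content_le Q U(2)) blast+
  also have "\<dots> \<le> (\<Sum>i. ennreal (c powr s) * diam_pow s (U i))"
  proof (intro suminf_le)
    fix i
    have b: "bounded (U i \<inter> A)"
      using P[OF U(2)] by (simp add: bounded_Int)
    have "diameter (f ` (U i \<inter> A)) \<le> c * diameter (U i \<inter> A)"
      using b lip \<open>c > 0\<close> by (intro diameter_image_le) auto
    also have "\<dots> \<le> c * diameter (U i)"
      using \<open>c > 0\<close> P[OF U(2)] by (intro mult_left_mono diameter_subset) auto
    finally have "diameter (f ` (U i \<inter> A)) powr s \<le> (c * diameter (U i)) powr s"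
      using \<open>s > 0\<close> b lip \<open>c > 0\<close>
      by (intro powr_mono2 diameter_ge_0 diameter_image_le[where c = c]) auto
    also have "\<dots> = c powr s * diameter (U i) powr s"
      using \<open>c > 0\<close> P[OF U(2)] by (simp add: powr_mult diameter_ge_0)
    finally show "diam_pow s (f ` (U i \<inter> A)) \<le> ennreal (c powr s) * diam_pow s (U i)"
      using \<open>s > 0\<close> by (simp add: diam_pow_pos flip: ennreal_mult)
  qed auto
  finally show "cover_content Q s (f ` A) \<le> ennreal (c powr s) * (\<Sum>i. diam_pow s (U i))"
    unfolding ennreal_suminf_cmult .
qed (use \<open>c > 0\<close> in auto)

lemma hausdorff_content_image_le:
  assumes "\<And>x y. x \<in> A \<Longrightarrow> y \<in> A \<Longrightarrow> dist (f x) (f y) \<le> c * dist x y" "c > 0" "s > 0"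
  shows "hausdorff_content s (f ` A) \<le> ennreal (c powr s) * hausdorff_content s A"
  using assms by (intro cover_content_image_le diameter_image_le(1)[where c = c]) auto

lemma hausdorff_content_less_top:
  assumes "bounded A"
  shows "hausdorff_content s A < top"
proof -
  have "hausdorff_content s A \<le> diam_pow s A"
  \<comment> \<open>The cover with the single member \<open>A\<close>, indexed by the unit
    type.\<close>
  proof (rule cover_content_le_countable[where C = "{()}" and U = "\<lambda>_. A"])
    fix F :: "unit set"
    assume "F \<subseteq> {()}"
    then consider "F = {}" | "F = {()}" by blast
    then show "(\<Sum>i\<in>F. diam_pow s A) \<le> diam_pow s A"
      by cases auto
  qed (use assms in auto)
  also have "\<dots> < top"
    by (simp add: diam_pow_def)
  finally show ?thesis .
qed

section \<open>Open covers and upper semicontinuity\<close>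

lemma open_superset_diameter_powr:
  fixes U :: "'a::metric_space set"
  assumes "bounded U" "s > 0" "e > 0"
  obtains W where "open W" "bounded W" "U \<subseteq> W" "diameter W powr s \<le> diameter U powr s + e"
proof (cases "U = {}")
  case True
  with that[of "{}"] assms show ?thesis by auto
next
  case False
  \<comment> \<open>A nonnegative base and \<open>s > 0\<close> make the power continuous also where
    \<open>diameter U = 0\<close>.\<close>
  have "\<forall>\<^sub>F \<eta> in at_right (0::real). 0 \<le> diameter U + 2 * \<eta>"
    using eventually_at_right_less[of 0] diameter_ge_0[OF assms(1)]
    by (auto elim!: eventually_mono)
  then have "((\<lambda>\<eta>. (diameter U + 2 * \<eta>) powr s) \<longlongrightarrow> (diameter U + 2 * 0) powr s) (at_right 0)"
    using assms diameter_ge_0[OF assms(1)]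
    by (intro tendsto_powr' tendsto_intros) auto
  then have "\<forall>\<^sub>F \<eta> in at_right 0. (diameter U + 2 * \<eta>) powr s < diameter U powr s + e"
    using assms by (intro order_tendstoD) auto
  then have "\<forall>\<^sub>F \<eta> in at_right 0. \<eta> > 0 \<and> (diameter U + 2 * \<eta>) powr s < diameter U powr s + e"
    by (intro eventually_conj eventually_at_right_less)
  then obtain \<eta> where \<eta>: "\<eta> > 0" "(diameter U + 2 * \<eta>) powr s < diameter U powr s + e"
    using eventually_happens'[OF trivial_limit_at_right_real] by blast
  \<comment> \<open>The \<open>\<eta>\<close>-neighbourhood of \<open>U\<close> is open, and its
    diameter exceeds that of \<open>U\<close> by at most \<open>2 * \<eta>\<close>.\<close>
  define W where "W = (\<Union>x\<in>U. ball x \<eta>)"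
  have W: "dist a b \<le> diameter U + 2 * \<eta>" if ab: "a \<in> W" "b \<in> W" for a b
  proof -
    obtain x where "x \<in> U" "dist x a < \<eta>"
      using ab(1) by (auto simp: W_def)
    moreover obtain y where "y \<in> U" "dist y b < \<eta>"
      using ab(2) by (auto simp: W_def)
    moreover from calculation have "dist x y \<le> diameter U"
      using assms diameter_bounded_bound by blast
    moreover have "dist a b \<le> dist x a + dist x y + dist y b"
      by (smt (verit) dist_commute dist_triangle)
    ultimately show ?thesis
      by simp
  qed
  have "U \<subseteq> W"
    using \<eta> by (auto simp: W_def)
  with False have "W \<noteq> {}" by auto
  then have bW: "bounded W"
    using W unfolding bounded_def by blast
  have "diameter W \<le> diameter U + 2 * \<eta>"
    unfolding diameter_def[of W] using \<open>W \<noteq> {}\<close> W by (auto intro!: cSUP_least)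
  then have "diameter W powr s \<le> (diameter U + 2 * \<eta>) powr s"
    using bW assms by (intro powr_mono2) (auto simp: diameter_ge_0)
  with \<eta>(2) \<open>U \<subseteq> W\<close> bW that[of W] show ?thesis
    by (auto simp: W_def)
qed

text \<open>Prepares for compactness arguments: the members of a near-optimal cover are enlarged to
  open sets, at a cost that is summable to any given \<open>e\<close>.\<close>

lemma hausdorff_content_open_coverE:
  fixes A :: "'a::metric_space set"
  assumes "hausdorff_content s A < a" "s > 0"
  obtains U :: "nat \<Rightarrow> 'a set" where "A \<subseteq> (\<Union>i. U i)" "\<And>i. open (U i)" "\<And>i. bounded (U i)"
    "(\<Sum>i. diam_pow s (U i)) < a"
proof -
  obtain U where U: "A \<subseteq> (\<Union>i. U i)" "\<And>i. bounded (U i)" "(\<Sum>i. diam_pow s (U i)) < a"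
    using assms(1) by (rule cover_content_lessE) blast
  have fin: "(\<Sum>i. diam_pow s (U i)) \<noteq> top"
    using U(3) by (auto simp: less_top[symmetric])
  \<comment> \<open>Room below \<open>a\<close>: half the gap if \<open>a\<close> is finite, any
    amount otherwise.\<close>
  obtain e where e: "e > 0" "(\<Sum>i. diam_pow s (U i)) + ennreal e < a"
  proof (cases a)
    case (real y)
    with fin obtain x where x: "(\<Sum>i. diam_pow s (U i)) = ennreal x" "x \<ge> 0"
      by (cases "\<Sum>i. diam_pow s (U i)") auto
    with U(3) real have "x < y"
      by (simp add: ennreal_less_iff)
    then have "x + (y - x) / 2 < y"
      by (simp add: field_simps)
    with x real that[of "(y - x) / 2"] \<open>x < y\<close> show ?thesis
      by (simp add: ennreal_less_iff flip: ennreal_plus)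
  next
    case top
    with fin have "(\<Sum>i. diam_pow s (U i)) + ennreal 1 < a"
      by (metis ennreal_add_eq_top ennreal_neq_top top.not_eq_extremum)
    with that[of 1] show ?thesis
      by simp
  qed
  have "\<forall>i. \<exists>W. open W \<and> bounded W \<and> U i \<subseteq> W \<and>
          diameter W powr s \<le> diameter (U i) powr s + e * (1/2) ^ Suc i"
  proof
    fix i
    have "e * (1/2) ^ Suc i > 0"
      using e by simp
    then show "\<exists>W. open W \<and> bounded W \<and> U i \<subseteq> W \<and>
          diameter W powr s \<le> diameter (U i) powr s + e * (1/2) ^ Suc i"
      by (rule open_superset_diameter_powr[OF U(2) assms(2)]) blast
  qed
  from choice[OF this] obtain W where W: "\<And>i. open (W i)" "\<And>i. bounded (W i)" "\<And>i. U i \<subseteq> W i"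
    "\<And>i. diameter (W i) powr s \<le> diameter (U i) powr s + e * (1/2) ^ Suc i"
    by (auto simp del: power_Suc)
  have "(\<Sum>i. diam_pow s (W i)) \<le> (\<Sum>i. diam_pow s (U i) + ennreal (e * (1/2) ^ Suc i))"
  proof (rule suminf_le)
    fix i
    show "diam_pow s (W i) \<le> diam_pow s (U i) + ennreal (e * (1/2) ^ Suc i)"
      using W(4)[of i] e assms by (simp add: diam_pow_pos flip: ennreal_plus)
  qed auto
  also have "\<dots> = (\<Sum>i. diam_pow s (U i)) + (\<Sum>i. ennreal (e * (1/2) ^ Suc i))"
    by (rule suminf_add[symmetric]) auto
  also have "(\<Sum>i. ennreal (e * (1/2) ^ Suc i)) = ennreal e"
    using sums_mult[OF power_half_series, of e] e by (intro suminf_ennreal_eq) auto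
  finally have "(\<Sum>i. diam_pow s (W i)) < a"
    using e by simp
  moreover have "A \<subseteq> (\<Union>i. W i)"
  proof
    fix x assume "x \<in> A"
    then obtain i where "x \<in> U i"
      using U(1) by auto
    with W(3)[of i] show "x \<in> (\<Union>i. W i)"
      by auto
  qed
  ultimately show ?thesis
    by (intro that[of W] W(1,2)) simp_all
qed

text \<open>A near-optimal open cover of the compact image contains a whole neighbourhood of it.
  Operators close to \<open>T\<close> map \<open>K\<close> into that neighbourhood, so the same
  cover serves them.\<close>

lemma hausdorff_content_image_upper_semicontinuous:
  fixes T :: "'a::euclidean_space \<Rightarrow>\<^sub>L 'b::euclidean_space"
  assumes K: "compact K" and s: "s > 0" and less: "hausdorff_content s (T ` K) < a"
  shows "\<exists>e>0. \<forall>T'. dist T' T < e \<longrightarrow> hausdorff_content s (blinfun_apply T' ` K) < a"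
proof -
  obtain U where U: "T ` K \<subseteq> (\<Union>i. U i)" "\<And>i. open (U i)" "\<And>i. bounded (U i)"
      "(\<Sum>i. diam_pow s (U i)) < a"
    using hausdorff_content_open_coverE[OF less s] by blast
  have "compact (T ` K)"
    using K by (intro compact_continuous_image continuous_intros)
  then obtain d where d: "d > 0" "(\<Union>y\<in>T ` K. ball y d) \<subseteq> (\<Union>i. U i)"
    using compact_subset_open_imp_ball_epsilon_subset[of "T ` K" "\<Union>i. U i"] U by blast
  obtain R where R: "R > 0" "\<And>x. x \<in> K \<Longrightarrow> norm x \<le> R"
    using compact_imp_bounded[OF K] by (auto simp: bounded_pos)
  have "hausdorff_content s (blinfun_apply T' ` K) < a" if "dist T' T < d / R" for T'
  proof -
    have "T' x \<in> (\<Union>i. U i)" if "x \<in> K" for x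
    proof -
      have "norm ((T' - T) x) \<le> norm (T' - T) * norm x"
        by (rule norm_blinfun)
      also have "\<dots> \<le> norm (T' - T) * R"
        using R(2)[OF that] by (intro mult_left_mono) auto
      also have "\<dots> < d"
        using \<open>dist T' T < d / R\<close> R(1) by (simp add: dist_norm field_simps)
      finally have "T' x \<in> ball (T x) d"
        by (simp add: dist_norm norm_minus_commute blinfun.diff_left)
      with d(2) that show ?thesis
        by blast
    qed
    then have "hausdorff_content s (blinfun_apply T' ` K) \<le> (\<Sum>i. diam_pow s (U i))"
      using U(3) by (intro cover_content_le) auto
    with U(4) show ?thesis
      by simp
  qed
  then show ?thesis
    using d(1) R(1) by (intro exI[of _ "d / R"]) auto
qed

text \<open>Without a maximum every \<open>x\<close> has a \<open>g x\<close> of larger value and a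
  neighbourhood where \<open>f\<close> stays below \<open>f (g x)\<close>. Finitely many of these
  cover \<open>G\<close>; the \<open>g z\<close> of largest value lies in one of them and would be
  exceeded by another \<open>g x\<close>.\<close>

lemma upper_semicontinuous_attains_max:
  fixes f :: "'m::metric_space \<Rightarrow> 'l::linorder"
  assumes "compact G" "G \<noteq> {}"
    and usc: "\<And>x a. x \<in> G \<Longrightarrow> f x < a \<Longrightarrow> \<exists>e>0. \<forall>y. dist y x < e \<longrightarrow> f y < a"
  shows "\<exists>x\<in>G. \<forall>y\<in>G. f y \<le> f x"
proof (rule ccontr)
  assume "\<not> ?thesis"
  then have "\<forall>x\<in>G. \<exists>y. y \<in> G \<and> f x < f y"
    by (auto simp: not_le)
  from bchoice[OF this] obtain g where g: "\<forall>x\<in>G. g x \<in> G \<and> f x < f (g x)" ..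
  have "\<forall>x\<in>G. \<exists>e>0. \<forall>y. dist y x < e \<longrightarrow> f y < f (g x)"
    using g usc by simp
  from bchoice[OF this] obtain e where e: "\<forall>x\<in>G. e x > 0 \<and> (\<forall>y. dist y x < e x \<longrightarrow> f y < f (g x))" ..
  have "G \<subseteq> (\<Union>x\<in>G. ball x (e x))"
    using e by auto
  then obtain X where X: "X \<subseteq> G" "finite X" "G \<subseteq> (\<Union>x\<in>X. ball x (e x))"
    using compactE_image[OF \<open>compact G\<close>, of G "\<lambda>x. ball x (e x)"] by auto
  have "X \<noteq> {}"
    using X \<open>G \<noteq> {}\<close> by auto
  define M where "M = Max ((f \<circ> g) ` X)"
  have "M \<in> (f \<circ> g) ` X"
    unfolding M_def using X \<open>X \<noteq> {}\<close> by (intro Max_in) auto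
  then obtain z where z: "z \<in> X" "f (g z) = M"
    by auto
  then have "g z \<in> G"
    using X g by blast
  then obtain x where x: "x \<in> X" "dist (g z) x < e x"
    using X(3) by (auto simp: dist_commute)
  then have "f (g z) < f (g x)"
    using e X(1) by blast
  also have "f (g x) \<le> M"
    unfolding M_def using X x by (intro Max_ge) auto
  finally show False
    using z by simp
qed

lemma blinfun_compose_assoc: "(f o\<^sub>L g) o\<^sub>L h = f o\<^sub>L (g o\<^sub>L h)"
  by (rule blinfun_eqI) simp

lemma blinfun_compose_id_left: "id_blinfun o\<^sub>L f = f"
  by (rule blinfun_eqI) simp

lemma blinfun_compose_id_right: "f o\<^sub>L id_blinfun = f"
  by (rule blinfun_eqI) simp

text \<open>The passage to the limit as \<open>a\<close> decreases to \<open>x\<close>; finiteness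
  of \<open>c\<close> makes a small error in \<open>a\<close> a small error in
  \<open>c * a\<close>.\<close>

lemma le_mult_ennrealI:
  fixes c x y :: ennreal
  assumes le: "\<And>a. x < a \<Longrightarrow> y \<le> c * a" and c: "c < top" and x: "x < top"
  shows "y \<le> c * x"
proof (rule ennreal_le_epsilon)
  fix e :: real
  assume "e > 0"
  obtain c' where c': "c = ennreal c'" "c' \<ge> 0"
    using c by (cases c) auto
  \<comment> \<open>The summand 1 keeps the denominator positive when \<open>c' = 0\<close>.\<close>
  define d where "d = e / (c' + 1)"
  have d: "d > 0" "c' * d \<le> e"
    using c'(2) \<open>e > 0\<close> by (auto simp: d_def field_simps)
  have "x < x + ennreal d"
    using x d(1) ennreal_add_left_cancel_less[of x 0 "ennreal d"] by simp
  then have "y \<le> c * (x + ennreal d)"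
    by (rule le)
  also have "\<dots> = c * x + ennreal (c' * d)"
    using c' d(1) by (simp add: distrib_left ennreal_mult)
  also have "\<dots> \<le> c * x + ennreal e"
    using d(2) by (intro add_left_mono ennreal_leI)
  finally show "y \<le> c * x + ennreal e" .
qed

section \<open>Disjoint cylinders and the dimension of the attractor\<close>

locale ss_attractor =
  fixes S :: "nat \<Rightarrow> 'a::euclidean_space \<Rightarrow> 'a" and m :: nat and K :: "'a set"
  assumes ifs: "ss_ifs m S" and attractor: "is_attractor m S K"
    and two_points: "\<exists>x\<in>K. \<exists>y\<in>K. x \<noteq> y"
begin

section \<open>Words, cylinders and their sizes\<close>

definition ratio :: "nat \<Rightarrow> real" where
  "ratio i = (SOME r. 0 < r \<and> r < 1 \<and> (\<forall>x y. dist (S i x) (S i y) = r * dist x y))"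

definition letters :: "nat set" where
  "letters = {1..m}"

abbreviation words :: "nat list set" where
  "words \<equiv> lists letters"

definition word_map :: "nat list \<Rightarrow> 'a \<Rightarrow> 'a" where
  "word_map w = foldr (\<lambda>i f. S i \<circ> f) w id"

definition scale :: "nat list \<Rightarrow> real" where
  "scale w = prod_list (map ratio w)"

abbreviation cyl :: "nat list \<Rightarrow> 'a set" where
  "cyl w \<equiv> word_map w ` K"

definition disjoint_cyls :: "nat list set \<Rightarrow> bool" where
  "disjoint_cyls F \<longleftrightarrow> finite F \<and> F \<subseteq> words \<and> pairwise (\<lambda>u v. disjnt (cyl u) (cyl v)) F"

lemma ratio:
  assumes "i \<in> letters"
  shows "0 < ratio i" "ratio i < 1" "dist (S i x) (S i y) = ratio i * dist x y"
proof -
  have "\<exists>r. 0 < r \<and> r < 1 \<and> (\<forall>x y. dist (S i x) (S i y) = r * dist x y)"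
    using ifs assms by (auto simp: ss_ifs_def contracting_similarity_def letters_def)
  from someI_ex[OF this]
  show "0 < ratio i" "ratio i < 1" "dist (S i x) (S i y) = ratio i * dist x y"
    unfolding ratio_def[symmetric] by blast+
qed

lemma attractor_eq: "K = (\<Union>i\<in>letters. S i ` K)"
  and compact_K: "compact K" and K_nonempty: "K \<noteq> {}"
  using attractor by (auto simp: is_attractor_def letters_def)

lemma bounded_K: "bounded K"
  using compact_K compact_imp_bounded by blast

lemma diameter_K_pos: "diameter K > 0"
proof -
  obtain x y where "x \<in> K" "y \<in> K" "x \<noteq> y"
    using two_points by blast
  then show ?thesis
    using diameter_bounded_bound[OF bounded_K, of x y] zero_less_dist_iff[of x y] by linarith
qed

lemma word_map_Nil [simp]: "word_map [] = id"
  and word_map_Cons: "word_map (i # w) = S i \<circ> word_map w"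
  by (simp_all add: word_map_def)

lemma word_map_append: "word_map (u @ v) = word_map u \<circ> word_map v"
  by (induction u) (auto simp: word_map_Cons)

lemma scale_Nil [simp]: "scale [] = 1"
  and scale_Cons: "scale (i # w) = ratio i * scale w"
  and scale_append: "scale (u @ v) = scale u * scale v"
  by (simp_all add: scale_def)

lemma scale_pos: "w \<in> words \<Longrightarrow> 0 < scale w"
  by (induction w rule: lists.induct) (auto simp: scale_Cons ratio)

lemma dist_word_map: "w \<in> words \<Longrightarrow> dist (word_map w x) (word_map w y) = scale w * dist x y"
  by (induction w rule: lists.induct) (auto simp: scale_Cons word_map_Cons ratio)

lemma cyl_subset: "w \<in> words \<Longrightarrow> cyl w \<subseteq> K"
proof (induction w rule: lists.induct)
  case (Cons i w)
  then have "cyl (i # w) \<subseteq> S i ` K"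
    by (auto simp: word_map_Cons)
  also have "\<dots> \<subseteq> K"
    using attractor_eq Cons by blast
  finally show ?case .
qed simp

lemma exists_cyl:
  assumes "x \<in> K"
  obtains w where "w \<in> words" "length w = n" "x \<in> cyl w"
proof -
  have "\<exists>w\<in>words. length w = n \<and> x \<in> cyl w"
    using assms
  proof (induction n arbitrary: x)
    case 0
    then show ?case by (intro bexI[of _ "[]"]) auto
  next
    case (Suc n)
    then obtain i y where i: "i \<in> letters" "y \<in> K" "x = S i y"
      using attractor_eq by blast
    with Suc.IH obtain w where "w \<in> words" "length w = n" "y \<in> cyl w"
      by blast
    with i show ?case
      by (intro bexI[of _ "i # w"]) (auto simp: word_map_Cons)
  qed
  with that show ?thesis by blast
qed

lemma finite_letters: "finite letters" and card_letters: "card letters = m"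
  by (simp_all add: letters_def)

lemma letters_nonempty: "letters \<noteq> {}"
  using attractor_eq K_nonempty by auto

lemma m_pos: "m > 0"
  using letters_nonempty finite_letters card_gt_0_iff[of letters] by (simp add: card_letters)

lemma scale_le_power:
  obtains q where "0 < q" "q < 1" "\<And>w. w \<in> words \<Longrightarrow> scale w \<le> q ^ length w"
proof -
  define q where "q = Max (ratio ` letters)"
  have ne: "ratio ` letters \<noteq> {}"
    using letters_nonempty by auto
  have "q \<in> ratio ` letters"
    unfolding q_def using ne finite_letters by (intro Max_in) auto
  then have q: "0 < q" "q < 1"
    using ratio by auto
  have le: "ratio i \<le> q" if "i \<in> letters" for i
    unfolding q_def using that finite_letters by (intro Max_ge) auto
  have "scale w \<le> q ^ length w" if "w \<in> words" for w
    using that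
  proof (induction w rule: lists.induct)
    case (Cons i w)
    then show ?case
      using q ratio[of i] le[of i] scale_pos[of w] by (auto simp: scale_Cons intro!: mult_mono)
  qed simp
  with q that show ?thesis by blast
qed

lemma scale_le_1: "w \<in> words \<Longrightarrow> scale w \<le> 1"
proof (induction w rule: lists.induct)
  case (Cons i w)
  then show ?case
    using ratio(1,2)[of i] scale_pos[of w] mult_le_one[of "ratio i" "scale w"] by (auto simp: scale_Cons)
qed simp

lemma scale_small:
  assumes "e > 0"
  obtains n where "\<And>w. w \<in> words \<Longrightarrow> n \<le> length w \<Longrightarrow> scale w < e"
proof -
  obtain q where q: "0 < q" "q < 1" "\<And>w. w \<in> words \<Longrightarrow> scale w \<le> q ^ length w"
    using scale_le_power by blast
  obtain n where n: "q ^ n < e"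
    using real_arch_pow_inv[OF assms q(2)] by blast
  have "scale w < e" if "w \<in> words" "n \<le> length w" for w
    using q(3)[OF that(1)] power_decreasing[OF that(2), of q] q(1,2) n by linarith
  with that show ?thesis by blast
qed

lemma dist_cyl_le:
  assumes "w \<in> words" "x \<in> cyl w" "y \<in> cyl w"
  shows "dist x y \<le> scale w * diameter K"
proof -
  obtain a b where ab: "a \<in> K" "b \<in> K" "x = word_map w a" "y = word_map w b"
    using assms by blast
  with dist_word_map[OF assms(1), of a b] have "dist x y = scale w * dist a b"
    by simp
  also have "\<dots> \<le> scale w * diameter K"
    using ab scale_pos[OF assms(1)] diameter_bounded_bound[OF bounded_K]
    by (intro mult_left_mono) auto
  finally show ?thesis .
qed

lemma compact_cyl:
  assumes "w \<in> words"
  shows "compact (cyl w)"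
proof (rule compact_continuous_image[OF _ compact_K])
  have "(scale w)-lipschitz_on K (word_map w)"
    using dist_word_map[OF assms] scale_pos[OF assms] by (intro lipschitz_onI) auto
  then show "continuous_on K (word_map w)"
    by (rule lipschitz_on_continuous_on)
qed

section \<open>Lower bounds for the dimension from disjoint cylinders\<close>

lemma disjoint_cyls_separated:
  assumes F: "disjoint_cyls F"
  obtains \<delta> where "\<delta> > 0"
    "\<And>u v x y. u \<in> F \<Longrightarrow> v \<in> F \<Longrightarrow> u \<noteq> v \<Longrightarrow> x \<in> cyl u \<Longrightarrow> y \<in> cyl v \<Longrightarrow> \<delta> \<le> dist x y"
proof -
  have *: "\<forall>p\<in>F \<times> F. \<exists>d>0. fst p \<noteq> snd p \<longrightarrow> (\<forall>x\<in>cyl (fst p). \<forall>y\<in>cyl (snd p). d \<le> dist x y)"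
  proof
    fix p assume p: "p \<in> F \<times> F"
    show "\<exists>d>0. fst p \<noteq> snd p \<longrightarrow> (\<forall>x\<in>cyl (fst p). \<forall>y\<in>cyl (snd p). d \<le> dist x y)"
    proof (cases "fst p = snd p")
      case True
      then show ?thesis
        by (intro exI[of _ 1]) simp
    next
      case False
      have "fst p \<in> words" "snd p \<in> words"
        using F p by (auto simp: disjoint_cyls_def)
      then have "compact (cyl (fst p))" "closed (cyl (snd p))"
        by (simp_all only: compact_imp_closed compact_cyl)
      moreover have "cyl (fst p) \<inter> cyl (snd p) = {}"
        using F p False by (simp add: disjoint_cyls_def pairwise_def disjnt_def mem_Times_iff)
      ultimately have "\<exists>d>0. \<forall>x\<in>cyl (fst p). \<forall>y\<in>cyl (snd p). d \<le> dist x y"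
        by (rule separate_compact_closed)
      then show ?thesis
        by blast
    qed
  qed
  from bchoice[OF *] obtain d where d': "\<forall>p\<in>F \<times> F. d p > 0 \<and>
      (fst p \<noteq> snd p \<longrightarrow> (\<forall>x\<in>cyl (fst p). \<forall>y\<in>cyl (snd p). d p \<le> dist x y))" ..
  have d: "d (u, v) > 0" "u \<noteq> v \<Longrightarrow> x \<in> cyl u \<Longrightarrow> y \<in> cyl v \<Longrightarrow> d (u, v) \<le> dist x y"
    if "u \<in> F" "v \<in> F" for u v x y
  proof -
    have "(u, v) \<in> F \<times> F"
      using that by simp
    from d'[rule_format, OF this]
    show "d (u, v) > 0" "u \<noteq> v \<Longrightarrow> x \<in> cyl u \<Longrightarrow> y \<in> cyl v \<Longrightarrow> d (u, v) \<le> dist x y"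
      by auto
  qed
  \<comment> \<open>\<open>insert 1\<close> keeps the minimum meaningful when \<open>F\<close> is
    empty.\<close>
  define \<delta> where "\<delta> = Min (insert 1 (d ` (F \<times> F)))"
  have fin: "finite F"
    using F by (simp add: disjoint_cyls_def)
  then have "\<delta> > 0"
    using d(1) by (auto simp: \<delta>_def)
  moreover have "\<delta> \<le> d (u, v)" if "u \<in> F" "v \<in> F" for u v
    unfolding \<delta>_def using that fin by (intro Min_le) auto
  ultimately show ?thesis
    using d(2) by (intro that[of \<delta>]) (blast intro: order_trans)+
qed

text \<open>A cover by sets too small to meet two of the cylinders splits into covers of the single
  cylinders, which can be rescaled to covers of the whole attractor with fewer members.\<close>

lemma finite_cover_lower_bound:
  fixes U :: "nat \<Rightarrow> 'a set"
  assumes F: "disjoint_cyls F" and uv: "u \<in> F" "v \<in> F" "u \<noteq> v" and s: "s > 0"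
    and sum: "1 \<le> (\<Sum>w\<in>F. scale w powr s)"
    and \<delta>: "\<delta> > 0"
    "\<And>u v x y. u \<in> F \<Longrightarrow> v \<in> F \<Longrightarrow> u \<noteq> v \<Longrightarrow> x \<in> cyl u \<Longrightarrow> y \<in> cyl v \<Longrightarrow> \<delta> \<le> dist x y"
    and J: "finite J" and cov: "K \<subseteq> (\<Union>j\<in>J. U j)" and bd: "\<And>j. j \<in> J \<Longrightarrow> bounded (U j)"
  shows "\<delta> powr s \<le> (\<Sum>j\<in>J. diameter (U j) powr s)"
  using J cov bd
proof (induction "card J" arbitrary: J U rule: less_induct)
  case less
  show ?case
  proof (cases "\<exists>j\<in>J. \<delta> \<le> diameter (U j)")
    case True
    then obtain j where j: "j \<in> J" "\<delta> \<le> diameter (U j)" by blast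
    then have "\<delta> powr s \<le> diameter (U j) powr s"
      using s \<delta> by (intro powr_mono2) auto
    also have "\<dots> \<le> (\<Sum>j\<in>J. diameter (U j) powr s)"
      using j less.prems by (intro member_le_sum) auto
    finally show ?thesis .
  next
    case False
    define I where "I w = {j \<in> J. U j \<inter> cyl w \<noteq> {}}" for w
    have fin: "finite F" "F \<subseteq> words"
      using F by (auto simp: disjoint_cyls_def)
    have I_fin: "finite (I w)" "I w \<subseteq> J" for w
      using less.prems by (auto simp: I_def)
    have cov_w: "cyl w \<subseteq> (\<Union>j\<in>I w. U j)" if "w \<in> F" for w
    proof
      fix x assume x: "x \<in> cyl w"
      then have "x \<in> K"
        using cyl_subset[of w] that fin(2) by blast
      then obtain j where "j \<in> J" "x \<in> U j"
        using less.prems(2) by blast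
      with x show "x \<in> (\<Union>j\<in>I w. U j)"
        unfolding I_def by blast
    qed
    have I_ne: "I w \<noteq> {}" if "w \<in> F" for w
      using cov_w[OF that] K_nonempty by auto
    have disj: "I w \<inter> I w' = {}" if "w \<in> F" "w' \<in> F" "w \<noteq> w'" for w w'
    proof (rule ccontr)
      assume "I w \<inter> I w' \<noteq> {}"
      then obtain j where "j \<in> I w" "j \<in> I w'"
        by blast
      then have "j \<in> J" "U j \<inter> cyl w \<noteq> {}" "U j \<inter> cyl w' \<noteq> {}"
        by (simp_all add: I_def)
      then obtain x y where "j \<in> J" "x \<in> U j" "x \<in> cyl w" "y \<in> U j" "y \<in> cyl w'"
        by blast
      then have "dist x y \<le> diameter (U j)" "\<not> \<delta> \<le> diameter (U j)"
        using less.prems(3) False by (auto intro: diameter_bounded_bound)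
      moreover have "\<delta> \<le> dist x y"
        using that \<open>x \<in> cyl w\<close> \<open>y \<in> cyl w'\<close> by (rule \<delta>(2))
      ultimately show False by linarith
    qed
    have w_bound: "scale w powr s * \<delta> powr s \<le> (\<Sum>j\<in>I w. diameter (U j) powr s)" if "w \<in> F" for w
    proof -
      have w: "w \<in> words"
        using that fin by auto
      \<comment> \<open>The cylinder of a second word meets some member of the cover, and
        \<open>disj\<close> keeps that member out of \<open>I w\<close>. This is the strict decrease
        on which the induction runs.\<close>
      obtain w' where "w' \<in> F" "w' \<noteq> w"
        using uv by metis
      with I_ne disj that have "I w \<subset> J"
        using I_fin by blast
      then have "card (I w) < card J"
        using less.prems by (intro psubset_card_mono)
      \<comment> \<open>Preimages under \<open>word_map w\<close> turn the cover of the cylinder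
        into a cover of \<open>K\<close>, enlarging diameters at most by the factor
        \<open>1 / scale w\<close>.\<close>
      moreover have "K \<subseteq> (\<Union>j\<in>I w. word_map w -` U j)"
        using cov_w[OF that] by blast
      moreover have inv: "bounded (word_map w -` U j) \<and>
          scale w * diameter (word_map w -` U j) \<le> diameter (U j)" if "j \<in> I w" for j
      proof -
        let ?V = "word_map w -` U j"
        have le: "dist x y \<le> diameter (U j) / scale w" if "x \<in> ?V" "y \<in> ?V" for x y
        proof -
          have "bounded (U j)"
            using \<open>j \<in> I w\<close> I_fin(2)[of w] by (intro less.prems(3)) blast
          then have "dist (word_map w x) (word_map w y) \<le> diameter (U j)"
            using that by (intro diameter_bounded_bound) simp_all
          then have "scale w * dist x y \<le> diameter (U j)"
            using dist_word_map[OF w] by simp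
          then show ?thesis
            using scale_pos[OF w] by (simp add: field_simps)
        qed
        obtain x where "x \<in> ?V"
          using \<open>j \<in> I w\<close> by (auto simp: I_def)
        then have "?V \<noteq> {}" by auto
        have "bounded ?V"
          using le \<open>x \<in> ?V\<close> unfolding bounded_def by blast
        moreover have "diameter ?V \<le> diameter (U j) / scale w"
          unfolding diameter_def[of ?V] using \<open>?V \<noteq> {}\<close> le by (auto intro!: cSUP_least)
        ultimately show ?thesis
          using scale_pos[OF w] by (simp add: field_simps)
      qed
      ultimately have "\<delta> powr s \<le> (\<Sum>j\<in>I w. diameter (word_map w -` U j) powr s)"
        using I_fin by (intro less.hyps) auto
      then have "scale w powr s * \<delta> powr s
          \<le> (\<Sum>j\<in>I w. scale w powr s * diameter (word_map w -` U j) powr s)"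
        by (simp add: sum_distrib_left[symmetric] mult_left_mono)
      also have "\<dots> \<le> (\<Sum>j\<in>I w. diameter (U j) powr s)"
      proof (rule sum_mono)
        fix j assume j: "j \<in> I w"
        have "scale w powr s * diameter (word_map w -` U j) powr s
            = (scale w * diameter (word_map w -` U j)) powr s"
          using inv[OF j] scale_pos[OF w] by (simp add: powr_mult diameter_ge_0)
        also have "\<dots> \<le> diameter (U j) powr s"
          using inv[OF j] scale_pos[OF w] s
          by (intro powr_mono2) (auto simp: diameter_ge_0 less_imp_le)
        finally show "scale w powr s * diameter (word_map w -` U j) powr s \<le> diameter (U j) powr s" .
      qed
      finally show ?thesis .
    qed
    \<comment> \<open>The factors \<open>scale w powr s\<close> lost by rescaling add up to at least
      1, and since the \<open>I w\<close> are disjoint no member of the cover is counted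
      twice.\<close>
    have "\<delta> powr s \<le> (\<Sum>w\<in>F. scale w powr s) * \<delta> powr s"
      using mult_right_mono[OF sum, of "\<delta> powr s"] by simp
    also have "\<dots> \<le> (\<Sum>w\<in>F. \<Sum>j\<in>I w. diameter (U j) powr s)"
      unfolding sum_distrib_right by (intro sum_mono w_bound)
    also have "\<dots> = (\<Sum>j\<in>(\<Union>w\<in>F. I w). diameter (U j) powr s)"
      using fin I_fin disj by (intro sum.UNION_disjoint[symmetric]) auto
    also have "\<dots> \<le> (\<Sum>j\<in>J. diameter (U j) powr s)"
      using less.prems(1) I_fin(2) by (intro sum_mono2 UN_least) simp_all
    finally show ?thesis .
  qed
qed

text \<open>By compactness an open cover may be taken finite;
  \<open>finite_cover_lower_bound\<close> then keeps its sum above a positive constant given by the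
  separation of the cylinders.\<close>

lemma hausdorff_measure_ne_0:
  assumes F: "disjoint_cyls F" and uv: "u \<in> F" "v \<in> F" "u \<noteq> v" and s: "s > 0"
    and sum: "1 \<le> (\<Sum>w\<in>F. scale w powr s)"
  shows "hausdorff_measure s K \<noteq> 0"
proof
  assume "hausdorff_measure s K = 0"
  then have 0: "hausdorff_content s K = 0"
    using hausdorff_content_le_measure[of s K] by simp
  obtain \<delta> where \<delta>: "\<delta> > 0"
    "\<And>u v x y. u \<in> F \<Longrightarrow> v \<in> F \<Longrightarrow> u \<noteq> v \<Longrightarrow> x \<in> cyl u \<Longrightarrow> y \<in> cyl v \<Longrightarrow> \<delta> \<le> dist x y"
    using disjoint_cyls_separated[OF F] by blast
  have "hausdorff_content s K < ennreal (\<delta> powr s)"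
    using 0 \<delta> by simp
  then obtain U where U: "K \<subseteq> (\<Union>i. U i)" "\<And>i. open (U i)" "\<And>i. bounded (U i)"
    "(\<Sum>i. diam_pow s (U i)) < ennreal (\<delta> powr s)"
    using s by (rule hausdorff_content_open_coverE) blast
  obtain J where J: "finite J" "K \<subseteq> (\<Union>i\<in>J. U i)"
    using compactE_image[OF compact_K, of UNIV U] U by auto
  have "\<delta> powr s \<le> (\<Sum>j\<in>J. diameter (U j) powr s)"
    by (rule finite_cover_lower_bound[OF F uv s sum \<delta>(1) _ J U(3)]) (rule \<delta>(2))
  then have "ennreal (\<delta> powr s) \<le> (\<Sum>j\<in>J. diam_pow s (U j))"
    using s by (simp add: diam_pow_pos sum_ennreal ennreal_leI)
  also have "\<dots> \<le> (\<Sum>j. diam_pow s (U j))"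
    using J(1) by (intro sum_le_suminf) auto
  finally show False
    using U(4) by simp
qed

text \<open>Shows that the infimum defining \<open>hausdorff_dim K\<close> is over a nonempty set.
  The \<open>m ^ n\<close> words of length \<open>n\<close> have cylinders of diameter at most
  \<open>q ^ n * diameter K\<close>, so for a large exponent their sums decay geometrically.\<close>

lemma exists_null_exponent: "\<exists>s\<ge>0. hausdorff_measure s K = 0"
proof -
  obtain q where q: "0 < q" "q < 1" "\<And>w. w \<in> words \<Longrightarrow> scale w \<le> q ^ length w"
    using scale_le_power by blast
  obtain k where k: "q ^ k < 1 / m"
    using real_arch_pow_inv[of "1 / m" q] q m_pos by auto
  define s where "s = real (Suc k)"
  have s: "s > 0" by (simp add: s_def)
  \<comment> \<open>This is \<open>m * q powr s\<close>, the factor gained with each additional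
    letter.\<close>
  define \<theta> where "\<theta> = m * q ^ Suc k"
  have "q ^ Suc k \<le> q ^ k"
    using q by (intro power_decreasing) auto
  with k have "q ^ Suc k < 1 / m"
    by linarith
  then have \<theta>: "0 \<le> \<theta>" "\<theta> < 1"
    using q m_pos by (auto simp: \<theta>_def field_simps)
  have bound: "hausdorff_content s K \<le> ennreal (\<theta> ^ n * diameter K powr s)" for n
  proof -
    let ?W = "{w. set w \<subseteq> letters \<and> length w = n}"
    have fin: "finite ?W"
      by (intro finite_lists_length_eq finite_letters)
    have "hausdorff_content s K \<le> (\<Sum>w\<in>?W. diam_pow s (cyl w))"
    proof (rule cover_content_le_countable[where P = bounded])
      show "countable ?W"
        using fin by (rule countable_finite)
      show "K \<subseteq> (\<Union>w\<in>?W. cyl w)"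
      proof
        fix x assume "x \<in> K"
        then obtain w where "w \<in> words" "length w = n" "x \<in> cyl w"
          by (rule exists_cyl)
        then show "x \<in> (\<Union>w\<in>?W. cyl w)"
          by (intro UN_I[of w]) auto
      qed
      show "(\<Sum>w\<in>G. diam_pow s (cyl w)) \<le> (\<Sum>w\<in>?W. diam_pow s (cyl w))" if "G \<subseteq> ?W" for G
        using that fin by (intro sum_mono2) auto
      show "bounded (cyl w)" if "w \<in> ?W" for w
        using that by (intro compact_imp_bounded compact_cyl) auto
    qed auto
    also have "\<dots> \<le> (\<Sum>w\<in>?W. ennreal ((q ^ n * diameter K) powr s))"
    proof (rule sum_mono)
      fix w assume "w \<in> ?W"
      then have w: "w \<in> words" "length w = n" by auto
      have "diameter (cyl w) \<le> scale w * diameter K"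
        using bounded_K scale_pos[OF w(1)] dist_word_map[OF w(1)] by (intro diameter_image_le) auto
      also have "\<dots> \<le> q ^ n * diameter K"
        using q(3)[OF w(1)] w diameter_K_pos by (intro mult_right_mono) auto
      finally show "diam_pow s (cyl w) \<le> ennreal ((q ^ n * diameter K) powr s)"
        using s compact_imp_bounded[OF compact_cyl[OF w(1)]]
        by (auto simp: diam_pow_pos diameter_ge_0 intro!: powr_mono2 ennreal_leI)
    qed
    also have "\<dots> = ennreal (m ^ n * (q ^ n * diameter K) powr s)"
      by (simp add: card_lists_length_eq finite_letters card_letters ennreal_mult ennreal_of_nat_eq_real_of_nat flip: ennreal_power)
    also have "m ^ n * (q ^ n * diameter K) powr s = \<theta> ^ n * diameter K powr s"
    proof -
      have "(q ^ n * diameter K) powr s = (q ^ n) powr s * diameter K powr s"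
        using q diameter_K_pos by (simp add: powr_mult)
      also have "(q ^ n) powr s = (q ^ Suc k) ^ n"
        unfolding s_def using q
        by (subst powr_realpow) (auto simp: power_mult[symmetric] mult.commute simp del: power_Suc)
      finally show ?thesis
        by (simp add: \<theta>_def power_mult_distrib)
    qed
    finally show ?thesis .
  qed
  have "(\<lambda>n. \<theta> ^ n * diameter K powr s) \<longlonglongrightarrow> 0 * diameter K powr s"
    using \<theta> by (intro tendsto_intros LIMSEQ_realpow_zero) auto
  then have "(\<lambda>n. ennreal (\<theta> ^ n * diameter K powr s)) \<longlonglongrightarrow> ennreal (0 * diameter K powr s)"
    by (rule tendsto_ennrealI)
  then have "hausdorff_content s K \<le> ennreal (0 * diameter K powr s)"
    using bound by (intro LIMSEQ_le_const) auto
  then have "hausdorff_measure s K = 0"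
    using s by (intro hausdorff_content_eq_0_imp_measure) auto
  with s show ?thesis by (intro exI[of _ s]) auto
qed

text \<open>Excludes the exponent 0, which \<open>hausdorff_measure_ne_0\<close> does not treat:
  every nonempty member of a cover counts 1 there.\<close>

lemma hausdorff_measure_0_ne_0: "hausdorff_measure 0 K \<noteq> 0"
proof
  assume "hausdorff_measure 0 K = 0"
  then have "hausdorff_content 0 K < 1"
    using hausdorff_content_le_measure[of 0 K] by simp
  then obtain U where U: "K \<subseteq> (\<Union>i. U i)" "(\<Sum>i. diam_pow 0 (U i)) < 1"
    by (rule cover_content_lessE) blast
  then obtain i where "U i \<noteq> {}"
    using K_nonempty by blast
  then have "diam_pow 0 (U i) = 1"
    by (simp add: diam_pow_def)
  with U(2) show False
    using ennreal_suminf_lessD[OF U(2), of i] by simp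
qed

text \<open>Scales are at most 1, so lowering the exponent keeps the sum at least 1. Hence no
  exponent below \<open>s\<close> can make \<open>K\<close> null.\<close>

lemma le_hausdorff_dim:
  assumes F: "disjoint_cyls F" and uv: "u \<in> F" "v \<in> F" "u \<noteq> v" and s: "s > 0"
    and sum: "1 \<le> (\<Sum>w\<in>F. scale w powr s)"
  shows "s \<le> hausdorff_dim K"
  unfolding hausdorff_dim_def
proof (rule cInf_greatest)
  show "{s. 0 \<le> s \<and> hausdorff_measure s K = 0} \<noteq> {}"
    using exists_null_exponent by auto
next
  fix s' assume s': "s' \<in> {s. 0 \<le> s \<and> hausdorff_measure s K = 0}"
  show "s \<le> s'"
  proof (rule ccontr)
    assume "\<not> s \<le> s'"
    have s'_null: "s' \<ge> 0" "hausdorff_measure s' K = 0"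
      using s' by simp_all
    then have "s' > 0"
      using hausdorff_measure_0_ne_0 by (cases "s' = 0") simp_all
    have "F \<subseteq> words"
      using F by (simp add: disjoint_cyls_def)
    have "(\<Sum>w\<in>F. scale w powr s) \<le> (\<Sum>w\<in>F. scale w powr s')"
    proof (rule sum_mono)
      fix w assume "w \<in> F"
      then have "w \<in> words"
        using \<open>F \<subseteq> words\<close> by blast
      then show "scale w powr s \<le> scale w powr s'"
        using \<open>\<not> s \<le> s'\<close> scale_pos[of w] scale_le_1[of w] by (intro powr_mono') auto
    qed
    with sum have "1 \<le> (\<Sum>w\<in>F. scale w powr s')" by linarith
    from hausdorff_measure_ne_0[OF F uv \<open>s' > 0\<close> this] s'_null(2) show False
      by contradiction
  qed
qed

text \<open>Distinct points lie in disjoint small cylinders, and the sum of the two powers of the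
  scales tends to 2 as the exponent decreases to 0.\<close>

lemma hausdorff_dim_pos: "hausdorff_dim K > 0"
proof -
  obtain x y where xy: "x \<in> K" "y \<in> K" "x \<noteq> y"
    using two_points by blast
  \<comment> \<open>The factor 2 makes the two cylinder diameters together smaller than
    \<open>dist x y\<close>.\<close>
  then have "dist x y / (2 * diameter K) > 0"
    using diameter_K_pos by simp
  then obtain n where n: "\<And>w. w \<in> words \<Longrightarrow> n \<le> length w \<Longrightarrow> scale w < dist x y / (2 * diameter K)"
    using scale_small by blast
  obtain u where u: "u \<in> words" "length u = n" "x \<in> cyl u"
    using exists_cyl[OF xy(1)] by blast
  obtain v where v: "v \<in> words" "length v = n" "y \<in> cyl v"
    using exists_cyl[OF xy(2)] by blast
  have "scale u < dist x y / (2 * diameter K)" "scale v < dist x y / (2 * diameter K)"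
    using n u v by auto
  then have small: "scale u * diameter K + scale v * diameter K < dist x y"
    using diameter_K_pos by (simp add: field_simps)
  have disj: "cyl u \<inter> cyl v = {}"
  proof (rule ccontr)
    assume "cyl u \<inter> cyl v \<noteq> {}"
    then obtain z where "z \<in> cyl u" "z \<in> cyl v" by blast
    then have "dist x z \<le> scale u * diameter K" "dist z y \<le> scale v * diameter K"
      using dist_cyl_le u v by blast+
    then show False
      using small dist_triangle[of x y z] by linarith
  qed
  then have "u \<noteq> v"
    using u by auto
  have F: "disjoint_cyls {u, v}"
    using u v disj by (auto simp: disjoint_cyls_def pairwise_def disjnt_def)
  have "((\<lambda>s. scale u powr s + scale v powr s) \<longlongrightarrow> scale u powr 0 + scale v powr 0) (at_right 0)"
    using scale_pos[OF u(1)] scale_pos[OF v(1)] by (intro tendsto_intros) auto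
  then have "\<forall>\<^sub>F s in at_right 0. scale u powr s + scale v powr s > 1"
    using scale_pos[OF u(1)] scale_pos[OF v(1)] by (intro order_tendstoD) auto
  then have "\<forall>\<^sub>F s in at_right 0. s > 0 \<and> scale u powr s + scale v powr s > 1"
    by (intro eventually_conj eventually_at_right_less)
  then obtain s where s: "s > 0" "scale u powr s + scale v powr s > 1"
    using eventually_happens'[OF trivial_limit_at_right_real] by blast
  have "s \<le> hausdorff_dim K"
    using F \<open>u \<noteq> v\<close> s by (intro le_hausdorff_dim[of "{u, v}" u v]) auto
  with s show ?thesis by simp
qed

abbreviation "t \<equiv> hausdorff_dim K"

text \<open>A sum above 1 would by continuity stay above 1 at some exponent larger than
  \<open>t\<close>, against \<open>le_hausdorff_dim\<close>. The two distinct words required there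
  exist because a single summand is at most 1.\<close>

lemma sum_scale_le_1:
  assumes F: "disjoint_cyls F"
  shows "(\<Sum>w\<in>F. scale w powr t) \<le> 1"
proof (rule ccontr)
  assume gt: "\<not> (\<Sum>w\<in>F. scale w powr t) \<le> 1"
  have fin: "finite F" "F \<subseteq> words"
    using F by (auto simp: disjoint_cyls_def)
  have le1: "scale w powr t \<le> 1" if "w \<in> F" for w
    using powr_mono2[of t "scale w" 1] that fin scale_pos[of w] scale_le_1[of w] hausdorff_dim_pos
    by (auto simp: subset_iff)
  obtain u v where uv: "u \<in> F" "v \<in> F" "u \<noteq> v"
  proof (cases "F = {}")
    case False
    then obtain u where u: "u \<in> F" by blast
    show ?thesis
    proof (cases "F = {u}")
      case True
      with gt le1 show ?thesis by simp
    next
      case False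
      with u that show ?thesis by blast
    qed
  qed (use gt in simp)
  have "((\<lambda>s. \<Sum>w\<in>F. scale w powr s) \<longlongrightarrow> (\<Sum>w\<in>F. scale w powr t)) (at_right t)"
    using scale_pos fin by (intro tendsto_intros) fastforce+
  then have "\<forall>\<^sub>F s in at_right t. (\<Sum>w\<in>F. scale w powr s) > 1"
    using gt by (intro order_tendstoD) auto
  then have "\<forall>\<^sub>F s in at_right t. s > t \<and> (\<Sum>w\<in>F. scale w powr s) > 1"
    by (intro eventually_conj eventually_at_right_less)
  then obtain s where s: "s > t" "(\<Sum>w\<in>F. scale w powr s) > 1"
    using eventually_happens'[OF trivial_limit_at_right_real] by blast
  have "s \<le> t"
    using F uv s hausdorff_dim_pos by (intro le_hausdorff_dim[of F u v]) auto
  with s show False by simp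
qed

section \<open>Filling relatively open sets by disjoint cylinders\<close>

abbreviation cyls :: "nat list set \<Rightarrow> 'a set" where
  "cyls F \<equiv> (\<Union>w\<in>F. cyl w)"

abbreviation weight :: "nat list set \<Rightarrow> real" where
  "weight F \<equiv> (\<Sum>w\<in>F. scale w powr t)"

text \<open>The length bound \<open>n\<close> forces the cylinders to be small, as estimates of the
  premeasure at a given mesh require.\<close>

definition packings :: "nat \<Rightarrow> 'a set \<Rightarrow> nat list set set" where
  "packings n V = {F. disjoint_cyls F \<and> (\<forall>w\<in>F. n \<le> length w \<and> cyl w \<subseteq> V)}"

definition max_weight :: "nat \<Rightarrow> 'a set \<Rightarrow> ennreal" where
  "max_weight n V = (SUP F\<in>packings n V. ennreal (weight F))"

lemma packingsD:
  assumes "F \<in> packings n V"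
  shows "finite F" "F \<subseteq> words" "disjoint_cyls F" "cyls F \<subseteq> V"
  using assms unfolding packings_def disjoint_cyls_def by blast+

lemma empty_packing: "{} \<in> packings n V"
  by (simp add: packings_def disjoint_cyls_def)

lemma weight_nonneg: "0 \<le> weight F"
  by (simp add: sum_nonneg)

lemma max_weight_upper: "F \<in> packings n V \<Longrightarrow> ennreal (weight F) \<le> max_weight n V"
  unfolding max_weight_def by (rule SUP_upper)

lemma max_weight_antimono: "n \<le> n' \<Longrightarrow> max_weight n' V \<le> max_weight n V"
  unfolding max_weight_def by (rule SUP_subset_mono) (auto simp: packings_def)

lemma max_weight_le_1: "max_weight n V \<le> 1"
  unfolding max_weight_def
  by (rule SUP_least) (auto intro: sum_scale_le_1 packingsD(3))

lemma cyl_nonempty: "cyl w \<noteq> {}"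
  using K_nonempty by simp

lemma packing_Un:
  assumes F: "F \<in> packings n V" and F': "F' \<in> packings n (V - cyls F)"
  shows "F \<union> F' \<in> packings n V" "F \<inter> F' = {}"
proof -
  have disj: "disjnt (cyl u) (cyl v)" if "u \<in> F" "v \<in> F'" for u v
    using that F' by (auto simp: packings_def disjnt_def)
  show "F \<inter> F' = {}"
  proof (rule ccontr)
    assume "F \<inter> F' \<noteq> {}"
    then obtain w where "w \<in> F" "w \<in> F'" by blast
    from disj[OF this] show False
      using cyl_nonempty by (simp add: disjnt_def)
  qed
  have "disjnt (cyl u) (cyl v)" if "u \<in> F \<union> F'" "v \<in> F \<union> F'" "u \<noteq> v" for u v
    using that disj[of u v] disj[of v u] packingsD(3)[OF F] packingsD(3)[OF F']
    by (auto simp: disjoint_cyls_def pairwise_def disjnt_sym)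
  then have "disjoint_cyls (F \<union> F')"
    using packingsD[OF F] packingsD[OF F'] by (simp add: disjoint_cyls_def pairwise_def)
  then show "F \<union> F' \<in> packings n V"
    using F F' unfolding packings_def by blast
qed

text \<open>Cylinders packed into the remainder are disjoint from those of \<open>F\<close>, so the
  two packings can be joined.\<close>

lemma max_weight_superadditive:
  assumes F: "F \<in> packings n V"
  shows "ennreal (weight F) + max_weight n (V - cyls F) \<le> max_weight n V"
proof -
  have "ennreal (weight F) + ennreal (weight F') \<le> max_weight n V"
    if F': "F' \<in> packings n (V - cyls F)" for F'
  proof -
    have "weight F + weight F' = weight (F \<union> F')"
      using packing_Un[OF F F'] packingsD(1)[OF F] packingsD(1)[OF F'] by (intro sum.union_disjoint[symmetric])
    then have "ennreal (weight F) + ennreal (weight F') = ennreal (weight (F \<union> F'))"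
      by (simp add: weight_nonneg flip: ennreal_plus)
    then show ?thesis
      using max_weight_upper[OF packing_Un(1)[OF F F']] by simp
  qed
  moreover have "packings n (V - cyls F) \<noteq> {}"
    using empty_packing by blast
  ultimately show ?thesis
    unfolding max_weight_def[of n "V - cyls F"]
    by (subst ennreal_SUP_add_right) (auto intro: SUP_least)
qed

text \<open>A packing close to the supremum, which is finite, leaves by superadditivity hardly any
  weight for the remainder.\<close>

lemma exists_good_packing:
  assumes "e > 0"
  obtains F where "F \<in> packings n V" "max_weight n (V - cyls F) \<le> ennreal e"
proof -
  have "\<exists>F\<in>packings n V. max_weight n V < ennreal (weight F) + ennreal e"
  proof (rule SUP_approx_ennreal[OF _ _ max_weight_def])
    show "max_weight n V \<noteq> \<infinity>"
    proof
      assume "max_weight n V = \<infinity>"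
      with max_weight_le_1[of n V] show False
        by (simp add: top_unique)
    qed
    show "packings n V \<noteq> {}"
      using empty_packing by blast
  qed (use assms in simp)
  then obtain F where F: "F \<in> packings n V" "max_weight n V \<le> ennreal (weight F) + ennreal e"
    using less_imp_le by blast
  have "ennreal (weight F) + max_weight n (V - cyls F) \<le> ennreal (weight F) + ennreal e"
    using max_weight_superadditive[OF F(1)] F(2) by (rule order_trans)
  then have "max_weight n (V - cyls F) \<le> ennreal e"
    by (simp add: ennreal_add_left_cancel_le)
  with F that show ?thesis by blast
qed

lemma exists_small_cyl:
  assumes V: "openin (top_of_set K) V" and "x \<in> V" and e: "e > 0"
  obtains w where "w \<in> words" "n \<le> length w" "x \<in> cyl w" "cyl w \<subseteq> V" "scale w < e"
proof -
  obtain d where d: "d > 0" "ball x d \<inter> K \<subseteq> V" and "x \<in> K"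
    using V \<open>x \<in> V\<close> unfolding openin_contains_ball by blast
  have "min e (d / diameter K) > 0"
    using d e diameter_K_pos by simp
  then obtain N where N: "\<And>w. w \<in> words \<Longrightarrow> N \<le> length w \<Longrightarrow> scale w < min e (d / diameter K)"
    using scale_small by blast
  obtain w where w: "w \<in> words" "length w = max n N" "x \<in> cyl w"
    using exists_cyl[OF \<open>x \<in> K\<close>] .
  have small: "scale w < e" "scale w * diameter K < d"
    using N[of w] w diameter_K_pos by (simp_all add: field_simps)
  have "cyl w \<subseteq> V"
  proof
    fix y assume y: "y \<in> cyl w"
    have "dist x y < d"
      using dist_cyl_le[OF w(1) w(3) y] small by linarith
    moreover have "y \<in> K"
      using cyl_subset[OF w(1)] y by blast
    ultimately show "y \<in> V"
      using d(2) by auto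
  qed
  with w small that show ?thesis by simp
qed

text \<open>Vitali's lemma for balls around tiny cylinders in \<open>V\<close>: the selected balls
  are disjoint, so finitely many of their cylinders form a packing, while the five-fold balls, of
  diameter at most ten radii, cover \<open>V\<close>.\<close>

lemma hausdorff_measure_le_max_weight:
  assumes V: "openin (top_of_set K) V"
  shows "hausdorff_measure t V \<le> ennreal ((10 * diameter K) powr t) * max_weight n V"
proof (rule hausdorff_measure_leI)
  fix \<delta> :: real
  assume "\<delta> > 0"
  define D where "D = diameter K"
  have D: "D > 0"
    using diameter_K_pos by (simp add: D_def)
  obtain z where z: "z \<in> K"
    using K_nonempty by blast
  \<comment> \<open>The threshold makes the five-fold balls have diameter at most
    \<open>\<delta>\<close>.\<close>
  define I where "I = {w \<in> words. n \<le> length w \<and> cyl w \<subseteq> V \<and> scale w < \<delta> / (10 * D)}"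
  define r where "r w = scale w * D" for w
  define a where "a w = word_map w z" for w
  have I_pos: "0 < r w \<and> r w \<le> D" if "w \<in> I" for w
    using that scale_pos[of w] scale_le_1[of w] D by (simp add: I_def r_def)
  have cyl_cball: "cyl w \<subseteq> cball (a w) (r w)" if "w \<in> words" for w
    using dist_cyl_le[OF that] z unfolding r_def a_def D_def by fastforce
  have "V \<subseteq> (\<Union>w\<in>I. cball (a w) (r w))"
  proof
    fix x assume "x \<in> V"
    moreover have "\<delta> / (10 * D) > 0"
      using \<open>\<delta> > 0\<close> D by simp
    ultimately obtain w where w: "w \<in> words" "n \<le> length w" "x \<in> cyl w" "cyl w \<subseteq> V" "scale w < \<delta> / (10 * D)"
      by (rule exists_small_cyl[OF V])
    then have "w \<in> I"
      by (simp add: I_def)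
    moreover have "x \<in> cball (a w) (r w)"
      using cyl_cball w by blast
    ultimately show "x \<in> (\<Union>w\<in>I. cball (a w) (r w))"
      by blast
  qed
  then obtain C where C: "countable C" "C \<subseteq> I"
    "pairwise (\<lambda>i j. disjnt (cball (a i) (r i)) (cball (a j) (r j))) C"
    "V \<subseteq> (\<Union>w\<in>C. cball (a w) (5 * r w))"
    using I_pos by (rule Vitali_covering_lemma_cballs)
  have diam: "diameter (cball (a w) (5 * r w)) \<le> 10 * r w" if "w \<in> C" for w
  proof (rule diameter_le)
    fix x y assume "x \<in> cball (a w) (5 * r w)" "y \<in> cball (a w) (5 * r w)"
    then show "norm (x - y) \<le> 10 * r w"
      using dist_triangle2[of x y "a w"] by (simp add: dist_norm norm_minus_commute)
  qed (use that C(2) I_pos[of w] in auto)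
  show "hausdorff_premeasure t \<delta> V \<le> ennreal ((10 * diameter K) powr t) * max_weight n V"
    unfolding hausdorff_premeasure_eq_cover_content
  proof (rule cover_content_le_countable[OF C(1) C(4)])
    fix w assume w: "w \<in> C"
    then have "10 * r w \<le> \<delta>"
      using C(2) D by (auto simp: I_def r_def field_simps)
    with diam[OF w] show "bounded (cball (a w) (5 * r w)) \<and> diameter (cball (a w) (5 * r w)) \<le> \<delta>"
      by simp
  next
    fix F assume F: "finite F" "F \<subseteq> C"
    have FI: "F \<subseteq> I" "F \<subseteq> words"
      using F C(2) by (auto simp: I_def)
    have "disjnt (cyl u) (cyl v)" if "u \<in> F" "v \<in> F" "u \<noteq> v" for u v
    proof -
      have "disjnt (cball (a u) (r u)) (cball (a v) (r v))"
        using C(3) F that unfolding pairwise_def by blast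
      moreover have "cyl u \<subseteq> cball (a u) (r u)" "cyl v \<subseteq> cball (a v) (r v)"
        using cyl_cball FI that by blast+
      ultimately show ?thesis
        unfolding disjnt_def by blast
    qed
    then have "F \<in> packings n V"
      using F FI unfolding packings_def disjoint_cyls_def pairwise_def I_def by blast
    have "(\<Sum>w\<in>F. diam_pow t (cball (a w) (5 * r w)))
        \<le> (\<Sum>w\<in>F. ennreal ((10 * D) powr t * scale w powr t))"
    proof (rule sum_mono)
      fix w assume w: "w \<in> F"
      then have "scale w > 0"
        using FI scale_pos by blast
      have "diameter (cball (a w) (5 * r w)) powr t \<le> (10 * r w) powr t"
        using diam[of w] w F hausdorff_dim_pos by (intro powr_mono2 diameter_ge_0) auto
      also have "\<dots> = (10 * D) powr t * scale w powr t"
        using D \<open>scale w > 0\<close> by (simp add: r_def powr_mult)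
      finally show "diam_pow t (cball (a w) (5 * r w)) \<le> ennreal ((10 * D) powr t * scale w powr t)"
        using hausdorff_dim_pos by (simp add: diam_pow_pos ennreal_leI)
    qed
    also have "\<dots> = ennreal ((10 * D) powr t) * ennreal (weight F)"
      by (simp add: sum_distrib_left[symmetric] weight_nonneg ennreal_mult)
    also have "\<dots> \<le> ennreal ((10 * D) powr t) * max_weight n V"
      by (intro mult_left_mono max_weight_upper \<open>F \<in> packings n V\<close>) simp
    finally show "(\<Sum>w\<in>F. diam_pow t (cball (a w) (5 * r w)))
        \<le> ennreal ((10 * diameter K) powr t) * max_weight n V"
      by (simp add: D_def)
  qed (use \<open>\<delta> > 0\<close> in auto)
qed

lemma closed_cyls: "finite F \<Longrightarrow> F \<subseteq> words \<Longrightarrow> closed (cyls F)"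
  by (intro closed_UN ballI compact_imp_closed compact_cyl) auto

lemma openin_diff_cyls:
  assumes "openin (top_of_set K) V" "finite F" "F \<subseteq> words"
  shows "openin (top_of_set K) (V - cyls F)"
proof -
  obtain T where "open T" "V = K \<inter> T"
    using assms(1) by (auto simp: openin_open)
  then show ?thesis
    using open_Diff[OF \<open>open T\<close> closed_cyls[OF assms(2,3)]]
    by (auto simp: openin_open Diff_eq Int_assoc)
qed

text \<open>Finitely many cylinders form a closed set, so the remainder is again relatively open and
  its measure is bounded by its small \<open>max_weight\<close>.\<close>

lemma exists_filling_packing:
  assumes V: "openin (top_of_set K) V" and e: "e > 0"
  obtains F where "F \<in> packings n V" "hausdorff_measure t (V - cyls F) \<le> ennreal e"
proof -
  define c where "c = (10 * diameter K) powr t"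
  have "c > 0"
    using diameter_K_pos by (simp add: c_def)
  then have "e / c > 0"
    using e by simp
  then obtain F where F: "F \<in> packings n V" "max_weight n (V - cyls F) \<le> ennreal (e / c)"
    by (rule exists_good_packing)
  have "hausdorff_measure t (V - cyls F) \<le> ennreal c * max_weight n (V - cyls F)"
    unfolding c_def by (intro hausdorff_measure_le_max_weight openin_diff_cyls V packingsD[OF F(1)])
  also have "\<dots> \<le> ennreal c * ennreal (e / c)"
    using F(2) by (rule mult_left_mono) simp
  also have "\<dots> = ennreal e"
    using \<open>c > 0\<close> e by (simp flip: ennreal_mult)
  finally show ?thesis
    using F that by blast
qed

section \<open>The content of linear images\<close>

definition linear_part :: "nat list \<Rightarrow> 'a \<Rightarrow>\<^sub>L 'a" where
  "linear_part w = Blinfun (\<lambda>x. (word_map w x - word_map w 0) /\<^sub>R scale w)"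

text \<open>The rescaled map is an isometry fixing 0, hence orthogonal and linear, so
  \<open>Blinfun\<close> really returns it. Bounded operators provide the metric for the closure in
  \<open>linear_parts\<close>.\<close>

lemma linear_part_apply:
  assumes "w \<in> words"
  shows "linear_part w x = (word_map w x - word_map w 0) /\<^sub>R scale w"
proof -
  let ?f = "\<lambda>x. (word_map w x - word_map w 0) /\<^sub>R scale w"
  have "dist (?f x) (?f y) = dist x y" for x y
  proof -
    have "?f x - ?f y = (word_map w x - word_map w y) /\<^sub>R scale w"
      by (simp add: algebra_simps)
    then have "dist (?f x) (?f y) = dist (word_map w x) (word_map w y) / scale w"
      using scale_pos[OF assms] by (simp add: dist_norm divide_inverse mult.commute)
    then show ?thesis
      using scale_pos[OF assms] dist_word_map[OF assms] by simp
  qed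
  then have "orthogonal_transformation ?f"
    unfolding orthogonal_transformation_isometry by simp
  then have "bounded_linear ?f"
    using orthogonal_transformation_linear linear_conv_bounded_linear by blast
  then show ?thesis
    unfolding linear_part_def by (subst bounded_linear_Blinfun_apply) auto
qed

lemma word_map_eq: "w \<in> words \<Longrightarrow> word_map w x = word_map w 0 + scale w *\<^sub>R linear_part w x"
  using scale_pos[of w] by (simp add: linear_part_apply)

lemma norm_linear_part: "w \<in> words \<Longrightarrow> norm (linear_part w x) = norm x"
  using scale_pos[of w] dist_word_map[of w x 0]
  by (simp add: linear_part_apply dist_norm divide_inverse[symmetric])

lemma linear_part_Nil: "linear_part [] = id_blinfun"
  by (rule blinfun_eqI) (simp add: linear_part_apply)

lemma linear_part_append:
  assumes "u \<in> words" "v \<in> words"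
  shows "linear_part (u @ v) = linear_part u o\<^sub>L linear_part v"
proof (rule blinfun_eqI)
  fix x
  have "u @ v \<in> words"
    using assms by auto
  have "linear_part u (linear_part v x) =
      (linear_part u (word_map v x) - linear_part u (word_map v 0)) /\<^sub>R scale v"
    using assms by (simp add: linear_part_apply[of v] blinfun.scaleR_right blinfun.diff_right)
  also have "\<dots> = linear_part (u @ v) x"
    using assms \<open>u @ v \<in> words\<close>
    by (simp add: linear_part_apply scale_append word_map_append scaleR_diff_right[symmetric])
  finally show "linear_part (u @ v) x = (linear_part u o\<^sub>L linear_part v) x"
    by simp
qed

definition linear_parts :: "('a \<Rightarrow>\<^sub>L 'a) set" where
  "linear_parts = closure (linear_part ` words)"

lemma linear_part_in_linear_parts: "w \<in> words \<Longrightarrow> linear_part w \<in> linear_parts"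
  unfolding linear_parts_def by (intro subsetD[OF closure_subset]) simp

lemma norm_linear_parts:
  assumes "P \<in> linear_parts"
  shows "norm (blinfun_apply P x) = norm x"
proof -
  have "closed {P. norm (blinfun_apply P x) = norm x}"
    by (intro closed_Collect_eq continuous_intros)
  moreover have "linear_part ` words \<subseteq> {P. norm (blinfun_apply P x) = norm x}"
    using norm_linear_part by auto
  ultimately have "linear_parts \<subseteq> {P. norm (blinfun_apply P x) = norm x}"
    unfolding linear_parts_def by (rule closure_minimal[rotated])
  with assms show ?thesis
    by blast
qed

lemma norm_linear_parts_le_1: "P \<in> linear_parts \<Longrightarrow> norm P \<le> 1"
  by (rule norm_blinfun_bound) (simp_all add: norm_linear_parts)

lemma compact_linear_parts: "compact linear_parts"
proof -
  have "bounded linear_parts"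
    using norm_linear_parts_le_1 unfolding bounded_iff by blast
  then show ?thesis
    by (simp add: compact_eq_bounded_closed linear_parts_def)
qed

text \<open>Concatenation of words gives the claim for linear parts themselves; continuity of
  composition extends it to limits, first in the left factor, then in the right one.\<close>

lemma compose_in_linear_parts:
  assumes P: "P \<in> linear_parts" and Q: "Q \<in> linear_parts"
  shows "P o\<^sub>L Q \<in> linear_parts"
proof -
  have word: "P o\<^sub>L linear_part v \<in> linear_parts" if v: "v \<in> words" for v
  proof -
    have "(\<lambda>P. P o\<^sub>L linear_part v) ` linear_part ` words \<subseteq> linear_part ` words"
    proof -
      have "linear_part u o\<^sub>L linear_part v \<in> linear_part ` words" if u: "u \<in> words" for u
        unfolding linear_part_append[OF u v, symmetric] using u v by (intro imageI) simp
      then show ?thesis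
        by blast
    qed
    then have "(\<lambda>P. P o\<^sub>L linear_part v) ` closure (linear_part ` words) \<subseteq> closure (linear_part ` words)"
      using closure_subset[of "linear_part ` words"]
      by (intro image_closure_subset continuous_intros closed_closure) (rule order_trans)
    with P show ?thesis
      unfolding linear_parts_def by blast
  qed
  have "(\<lambda>Q. P o\<^sub>L Q) ` closure (linear_part ` words) \<subseteq> linear_parts"
    using word by (intro image_closure_subset continuous_intros) (simp_all add: linear_parts_def image_subset_iff)
  with Q show ?thesis
    unfolding linear_parts_def by blast
qed

text \<open>A compact semigroup of isometries is a group: some power \<open>P\<^sup>k\<close> with \<open>k \<ge> 1\<close> is close to the
  identity, and \<open>P\<^sup>k\<^sup>-\<^sup>1\<close> is a limit of linear parts of words.\<close>

lemma exists_almost_inverse_word: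
  assumes P: "P \<in> linear_parts" and e: "e > 0"
  obtains v where "v \<in> words" "dist (P o\<^sub>L linear_part v) id_blinfun < e"
proof -
  define X where "X k = (((o\<^sub>L) P) ^^ k) id_blinfun" for k
  have X_Suc: "X (Suc k) = P o\<^sub>L X k" for k
    by (simp add: X_def)
  have X_0: "X 0 = id_blinfun"
    by (simp add: X_def)
  have X_in: "X k \<in> linear_parts" for k
  proof (induction k)
    case 0
    then show ?case
      using linear_part_in_linear_parts[of "[]"] by (simp add: X_0 linear_part_Nil)
  next
    case (Suc k)
    with P show ?case
      unfolding X_Suc by (intro compose_in_linear_parts)
  qed
  have X_add: "X (i + j) = X i o\<^sub>L X j" for i j
    by (induction i) (auto simp: X_0 X_Suc blinfun_compose_assoc blinfun_compose_id_left)
  obtain r l where r: "strict_mono r" "(X \<circ> r) \<longlonglongrightarrow> l"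
    using compact_linear_parts X_in unfolding compact_def by metis
  \<comment> \<open>Two different powers of \<open>P\<close> are close because a convergent
    subsequence is Cauchy.\<close>
  then have "Cauchy (X \<circ> r)"
    by (intro LIMSEQ_imp_Cauchy)
  then obtain N where N: "dist ((X \<circ> r) (Suc N)) ((X \<circ> r) N) < e / 2"
    using e by (metis Cauchy_def half_gt_zero le_refl le_Suc_eq)
  have "r N < r (Suc N)"
    using r(1) by (simp add: strict_mono_less)
  then obtain k where k: "r (Suc N) = r N + Suc k"
    using less_iff_Suc_add by auto
  define Q where "Q = X (Suc k)"
  \<comment> \<open>The common power \<open>X (r N)\<close> is an isometry and can be cancelled, so
    \<open>Q\<close> is as close to the identity as the two powers are to each other.\<close>
  have "norm (Q - id_blinfun) \<le> norm (X (r (Suc N)) - X (r N))"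
  proof (rule norm_blinfun_bound)
    fix x
    have "(X (r (Suc N)) - X (r N)) x = X (r N) ((Q - id_blinfun) x)"
      unfolding k X_add Q_def[symmetric] by (simp add: blinfun.diff_left blinfun.diff_right)
    then have "norm ((X (r (Suc N)) - X (r N)) x) = norm ((Q - id_blinfun) x)"
      by (simp add: norm_linear_parts[OF X_in])
    then show "norm ((Q - id_blinfun) x) \<le> norm (X (r (Suc N)) - X (r N)) * norm x"
      using norm_blinfun[of "X (r (Suc N)) - X (r N)" x] by simp
  qed simp
  with N have Q: "dist Q id_blinfun < e / 2"
    by (simp add: dist_norm)
  \<comment> \<open>\<open>P\<close> composed with \<open>X k\<close> is \<open>Q\<close>, so
    \<open>X k\<close> is almost an inverse of \<open>P\<close>, and a word approximates it.\<close>
  have "\<exists>y\<in>linear_part ` words. dist y (X k) < e / 2"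
    using X_in[of k] half_gt_zero[OF e] unfolding linear_parts_def closure_approachable by blast
  then obtain v where v: "v \<in> words" "dist (linear_part v) (X k) < e / 2"
    by blast
  have "norm (P o\<^sub>L (linear_part v - X k)) \<le> norm P * norm (linear_part v - X k)"
    by (rule norm_blinfun_compose)
  also have "\<dots> \<le> 1 * norm (linear_part v - X k)"
    using norm_linear_parts_le_1[OF P] by (intro mult_right_mono) auto
  also have "P o\<^sub>L (linear_part v - X k) = (P o\<^sub>L linear_part v) - Q"
    by (simp add: Q_def X_Suc bounded_bilinear.diff_right[OF bounded_bilinear_blinfun_compose])
  finally have "dist (P o\<^sub>L linear_part v) Q < e / 2"
    using v(2) by (simp add: dist_norm)
  with Q have "dist (P o\<^sub>L linear_part v) id_blinfun < e"
    using dist_triangle[of "P o\<^sub>L linear_part v" id_blinfun Q] by linarith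
  with v(1) that show ?thesis
    by blast
qed

section \<open>A maximum principle for the content of linear images\<close>

definition image_content :: "('a \<Rightarrow>\<^sub>L 'b::euclidean_space) \<Rightarrow> ennreal" where
  "image_content T = hausdorff_content t (T ` K)"

text \<open>The constant is \<open>norm T + 1\<close> so that it stays positive for
  \<open>T = 0\<close>.\<close>

lemma hausdorff_content_linear_image_le:
  fixes T :: "'a \<Rightarrow>\<^sub>L 'b::euclidean_space"
  shows "hausdorff_content t (T ` X) \<le> ennreal ((norm T + 1) powr t) * hausdorff_content t X"
proof (rule hausdorff_content_image_le)
  fix x y :: 'a
  have "dist (T x) (T y) = norm (T (x - y))"
    by (simp add: dist_norm blinfun.diff_right)
  also have "\<dots> \<le> norm T * norm (x - y)"
    by (rule norm_blinfun)
  also have "\<dots> \<le> (norm T + 1) * norm (x - y)"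
    by (intro mult_right_mono) auto
  finally show "dist (T x) (T y) \<le> (norm T + 1) * dist x y"
    by (simp add: dist_norm)
qed (use hausdorff_dim_pos in \<open>auto intro: add_nonneg_pos\<close>)

lemma image_content_less_top: "image_content T < top"
  unfolding image_content_def
  by (intro hausdorff_content_less_top compact_imp_bounded compact_continuous_image compact_K
      continuous_intros)

text \<open>By \<open>word_map_eq\<close> the image of the cylinder is a translate of the image of
  \<open>K\<close> under \<open>T o\<^sub>L linear_part w\<close>, scaled by
  \<open>scale w\<close>.\<close>

lemma hausdorff_content_linear_image_cyl_le:
  fixes T :: "'a \<Rightarrow>\<^sub>L 'b::euclidean_space"
  assumes w: "w \<in> words"
  shows "hausdorff_content t (T ` cyl w) \<le> ennreal (scale w powr t) * image_content (T o\<^sub>L linear_part w)"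
proof -
  have eq: "T (word_map w x) = T (word_map w 0) + scale w *\<^sub>R (T o\<^sub>L linear_part w) x" for x
    by (subst word_map_eq[OF w]) (simp add: blinfun.add_right blinfun.scaleR_right)
  have "T ` cyl w = (\<lambda>z. T (word_map w 0) + scale w *\<^sub>R z) ` (T o\<^sub>L linear_part w) ` K"
    unfolding image_image by (intro image_cong refl eq)
  also have "hausdorff_content t \<dots> \<le> ennreal (scale w powr t) * hausdorff_content t ((T o\<^sub>L linear_part w) ` K)"
  proof (rule hausdorff_content_image_le)
    fix x y :: 'b
    show "dist (T (word_map w 0) + scale w *\<^sub>R x) (T (word_map w 0) + scale w *\<^sub>R y) \<le> scale w * dist x y"
      using scale_pos[OF w] by (simp add: dist_norm flip: scaleR_diff_right)
  qed (use scale_pos[OF w] hausdorff_dim_pos in simp_all)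
  finally show ?thesis
    unfolding image_content_def .
qed

text \<open>\<open>Y\<close> stands for the remainder of small measure that a packing
  leaves.\<close>

lemma hausdorff_content_linear_image_cyls_le:
  fixes T :: "'a \<Rightarrow>\<^sub>L 'b::euclidean_space"
  assumes F: "finite F" "F \<subseteq> words" and "X \<subseteq> cyls F \<union> Y"
  shows "hausdorff_content t (T ` X)
    \<le> (\<Sum>w\<in>F. ennreal (scale w powr t) * image_content (T o\<^sub>L linear_part w))
      + ennreal ((norm T + 1) powr t) * hausdorff_measure t Y"
proof -
  have "hausdorff_content t (T ` X) \<le> hausdorff_content t ((\<Union>w\<in>F. T ` cyl w) \<union> T ` Y)"
    using assms(3) by (intro cover_content_mono) blast
  also have "\<dots> \<le> hausdorff_content t (\<Union>w\<in>F. T ` cyl w) + hausdorff_content t (T ` Y)"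
    by (rule cover_content_Un_le) simp
  also have "\<dots> \<le> (\<Sum>w\<in>F. ennreal (scale w powr t) * image_content (T o\<^sub>L linear_part w))
      + ennreal ((norm T + 1) powr t) * hausdorff_measure t Y"
  proof (rule add_mono)
    have "hausdorff_content t (\<Union>w\<in>F. T ` cyl w) \<le> (\<Sum>w\<in>F. hausdorff_content t (T ` cyl w))"
      using F(1) by (intro cover_content_UN_finite_le) simp_all
    also have "\<dots> \<le> (\<Sum>w\<in>F. ennreal (scale w powr t) * image_content (T o\<^sub>L linear_part w))"
      using F(2) by (intro sum_mono hausdorff_content_linear_image_cyl_le) blast
    finally show "hausdorff_content t (\<Union>w\<in>F. T ` cyl w)
      \<le> (\<Sum>w\<in>F. ennreal (scale w powr t) * image_content (T o\<^sub>L linear_part w))" .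
    have "hausdorff_content t (T ` Y) \<le> ennreal ((norm T + 1) powr t) * hausdorff_content t Y"
      by (rule hausdorff_content_linear_image_le)
    also have "\<dots> \<le> ennreal ((norm T + 1) powr t) * hausdorff_measure t Y"
      by (intro mult_left_mono hausdorff_content_le_measure) simp
    finally show "hausdorff_content t (T ` Y) \<le> ennreal ((norm T + 1) powr t) * hausdorff_measure t Y" .
  qed
  finally show ?thesis .
qed

lemma exists_filling_packing_linear:
  fixes T :: "'a \<Rightarrow>\<^sub>L 'b::euclidean_space"
  assumes V: "openin (top_of_set K) V" and e: "e > 0"
  obtains F where "F \<in> packings n V"
    "ennreal ((norm T + 1) powr t) * hausdorff_measure t (V - cyls F) \<le> ennreal e"
proof -
  let ?c = "(norm T + 1) powr t"
  have c: "?c > 0"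
    using norm_ge_zero[of T] by (simp add: add_nonneg_eq_0_iff)
  then have "e / ?c > 0"
    using e by simp
  then obtain F where F: "F \<in> packings n V" "hausdorff_measure t (V - cyls F) \<le> ennreal (e / ?c)"
    by (rule exists_filling_packing[OF V])
  have "ennreal ?c * hausdorff_measure t (V - cyls F) \<le> ennreal ?c * ennreal (e / ?c)"
    using F(2) by (rule mult_left_mono) simp
  also have "\<dots> = ennreal e"
    using c e by (simp flip: ennreal_mult)
  finally show ?thesis
    using F(1) that by blast
qed

lemma openin_Diff_cyl: "v \<in> words \<Longrightarrow> openin (top_of_set K) (K - cyl v)"
  using openin_diff_cyls[of K "{v}"] by simp

text \<open>The packing starts with \<open>v\<close> and is completed by filling the complement of
  its cylinder. Since the total weight is at most 1, the other words share at most
  \<open>1 - scale v powr t\<close>.\<close>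

lemma image_content_subharmonic:
  fixes T :: "'a \<Rightarrow>\<^sub>L 'b::euclidean_space"
  assumes v: "v \<in> words" and M: "\<And>w. w \<in> words \<Longrightarrow> image_content (T o\<^sub>L linear_part w) \<le> M"
  shows "image_content T \<le> ennreal (scale v powr t) * image_content (T o\<^sub>L linear_part v)
      + ennreal (1 - scale v powr t) * M"
proof (rule ennreal_le_epsilon)
  fix e :: real
  assume "e > 0"
  then obtain F where F: "F \<in> packings 0 (K - cyl v)"
    "ennreal ((norm T + 1) powr t) * hausdorff_measure t ((K - cyl v) - cyls F) \<le> ennreal e"
    by (rule exists_filling_packing_linear[OF openin_Diff_cyl[OF v]])
  have v_packing: "{v} \<in> packings 0 K"
    using v cyl_subset[OF v] by (simp add: packings_def disjoint_cyls_def)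
  have F': "F \<in> packings 0 (K - cyls {v})"
    using F(1) by simp
  have "v \<notin> F"
    using packing_Un(2)[OF v_packing F'] by simp
  have "weight (insert v F) \<le> 1"
    using packing_Un(1)[OF v_packing F'] by (intro sum_scale_le_1 packingsD(3)) simp
  then have weight_F: "weight F \<le> 1 - scale v powr t"
    using \<open>v \<notin> F\<close> packingsD(1)[OF F(1)] by simp
  have "image_content T \<le> (\<Sum>w\<in>insert v F. ennreal (scale w powr t) * image_content (T o\<^sub>L linear_part w))
      + ennreal ((norm T + 1) powr t) * hausdorff_measure t ((K - cyl v) - cyls F)"
    unfolding image_content_def[of T]
    using v packingsD[OF F(1)] by (intro hausdorff_content_linear_image_cyls_le) auto
  also have "\<dots> \<le> (\<Sum>w\<in>insert v F. ennreal (scale w powr t) * image_content (T o\<^sub>L linear_part w)) + ennreal e"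
    using F(2) by (rule add_left_mono)
  also have "(\<Sum>w\<in>insert v F. ennreal (scale w powr t) * image_content (T o\<^sub>L linear_part w))
     = ennreal (scale v powr t) * image_content (T o\<^sub>L linear_part v)
      + (\<Sum>w\<in>F. ennreal (scale w powr t) * image_content (T o\<^sub>L linear_part w))"
    using \<open>v \<notin> F\<close> packingsD(1)[OF F(1)] by (rule sum.insert[rotated])
  also have "(\<Sum>w\<in>F. ennreal (scale w powr t) * image_content (T o\<^sub>L linear_part w)) \<le> (\<Sum>w\<in>F. ennreal (scale w powr t) * M)"
    using packingsD(2)[OF F(1)] by (intro sum_mono mult_left_mono M) auto
  also have "(\<Sum>w\<in>F. ennreal (scale w powr t) * M) = ennreal (weight F) * M"
    by (simp add: sum_distrib_right[symmetric])
  also have "\<dots> \<le> ennreal (1 - scale v powr t) * M"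
    using weight_F by (intro mult_right_mono ennreal_leI) auto
  finally show "image_content T \<le> ennreal (scale v powr t) * image_content (T o\<^sub>L linear_part v)
      + ennreal (1 - scale v powr t) * M + ennreal e"
    by (simp add: add_left_mono add_right_mono)
qed

text \<open>At a maximiser \<open>P\<close> over \<open>linear_parts\<close> the subharmonic
  inequality forces every \<open>P o\<^sub>L linear_part v\<close> to be a maximiser too. Some of
  these approach the identity, and upper semicontinuity carries the maximal value over to
  it.\<close>

lemma image_content_linear_part_le:
  fixes T :: "'a \<Rightarrow>\<^sub>L 'b::euclidean_space"
  assumes w: "w \<in> words"
  shows "image_content (T o\<^sub>L linear_part w) \<le> image_content T"
proof -
  have usc: "\<exists>e>0. \<forall>Q. dist Q P < e \<longrightarrow> image_content (T o\<^sub>L Q) < a"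
    if less: "image_content (T o\<^sub>L P) < a" for P a
  proof -
    obtain e where e: "e > 0" "\<forall>T'. dist T' (T o\<^sub>L P) < e \<longrightarrow> image_content T' < a"
      using hausdorff_content_image_upper_semicontinuous[OF compact_K hausdorff_dim_pos]
        less[unfolded image_content_def] unfolding image_content_def by blast
    have "isCont (\<lambda>Q. T o\<^sub>L Q) P"
      by (intro linear_continuous_at bounded_bilinear.bounded_linear_right[OF bounded_bilinear_blinfun_compose])
    then obtain d where "d > 0" "\<forall>Q. dist Q P < d \<longrightarrow> dist (T o\<^sub>L Q) (T o\<^sub>L P) < e"
      using e(1) unfolding continuous_at_eps_delta by blast
    with e(2) show ?thesis
      by blast
  qed
  have "linear_parts \<noteq> {}"
    using linear_part_in_linear_parts[OF w] by blast
  then obtain P where P: "P \<in> linear_parts"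
    "\<And>Q. Q \<in> linear_parts \<Longrightarrow> image_content (T o\<^sub>L Q) \<le> image_content (T o\<^sub>L P)"
    using upper_semicontinuous_attains_max[OF compact_linear_parts, of "\<lambda>P. image_content (T o\<^sub>L P)"] usc
    by blast
  define M where "M = image_content (T o\<^sub>L P)"
  obtain M' where M': "M = ennreal M'" "M' \<ge> 0"
    using image_content_less_top[of "T o\<^sub>L P"] unfolding M_def[symmetric] by (cases M) auto
  have le_M: "image_content (T o\<^sub>L P o\<^sub>L linear_part v) \<le> M" if "v \<in> words" for v
    unfolding M_def blinfun_compose_assoc
    using P(1) that by (intro P(2) compose_in_linear_parts linear_part_in_linear_parts)
  \<comment> \<open>\<open>M\<close> is at most an average of this value and \<open>M\<close>, and
    the weight \<open>p\<close> of this value is positive; finiteness of \<open>M\<close> allows the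
    cancellation.\<close>
  have ge_M: "M \<le> image_content (T o\<^sub>L (P o\<^sub>L linear_part v))" if v: "v \<in> words" for v
  proof -
    define p where "p = scale v powr t"
    have p: "0 < p" "p \<le> 1"
      using scale_pos[OF v] scale_le_1[OF v] hausdorff_dim_pos powr_mono2[of t "scale v" 1]
      by (auto simp: p_def)
    obtain a where a: "image_content (T o\<^sub>L P o\<^sub>L linear_part v) = ennreal a" "a \<ge> 0"
      using image_content_less_top[of "T o\<^sub>L P o\<^sub>L linear_part v"]
      by (cases "image_content (T o\<^sub>L P o\<^sub>L linear_part v)") auto
    have "M \<le> ennreal p * image_content (T o\<^sub>L P o\<^sub>L linear_part v) + ennreal (1 - p) * M"
      unfolding p_def using image_content_subharmonic[OF v le_M] by (simp add: M_def)
    then have "M' \<le> p * a + (1 - p) * M'"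
      using p M' a by (simp add: ennreal_le_iff flip: ennreal_mult ennreal_plus)
    then have "p * M' \<le> p * a"
      by (simp add: algebra_simps)
    with p have "M' \<le> a"
      by simp
    with M' a show ?thesis
      by (simp add: blinfun_compose_assoc ennreal_leI)
  qed
  have "M \<le> image_content (T o\<^sub>L id_blinfun)"
  proof (rule ccontr)
    assume "\<not> M \<le> image_content (T o\<^sub>L id_blinfun)"
    then obtain e where e: "e > 0" "\<forall>Q. dist Q id_blinfun < e \<longrightarrow> image_content (T o\<^sub>L Q) < M"
      using usc[of id_blinfun M] by (auto simp: not_le)
    obtain v where "v \<in> words" "dist (P o\<^sub>L linear_part v) id_blinfun < e"
      using exists_almost_inverse_word[OF P(1) e(1)] by blast
    with e(2) ge_M[of v] show False
      by (meson leD)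
  qed
  moreover have "image_content (T o\<^sub>L linear_part w) \<le> M"
    unfolding M_def by (rule P(2)[OF linear_part_in_linear_parts[OF w]])
  ultimately show ?thesis
    unfolding blinfun_compose_id_right by (rule order_trans[rotated])
qed

lemma sum_scale_mult: "(\<Sum>w\<in>F. ennreal (scale w powr t) * c) = c * ennreal (weight F)"
  unfolding mult.commute[of c] by (simp add: sum_distrib_right[symmetric])

section \<open>Content and measure of relatively open sets\<close>

lemma hausdorff_content_image_le_max_weight:
  fixes T :: "'a \<Rightarrow>\<^sub>L 'b::euclidean_space"
  assumes V: "openin (top_of_set K) V"
  shows "hausdorff_content t (T ` V) \<le> image_content T * max_weight n V"
proof (rule ennreal_le_epsilon)
  fix e :: real
  assume "e > 0"
  then obtain F where F: "F \<in> packings n V"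
    "ennreal ((norm T + 1) powr t) * hausdorff_measure t (V - cyls F) \<le> ennreal e"
    by (rule exists_filling_packing_linear[OF V])
  have "hausdorff_content t (T ` V)
    \<le> (\<Sum>w\<in>F. ennreal (scale w powr t) * image_content (T o\<^sub>L linear_part w))
      + ennreal ((norm T + 1) powr t) * hausdorff_measure t (V - cyls F)"
    using packingsD[OF F(1)] by (intro hausdorff_content_linear_image_cyls_le) auto
  also have "\<dots> \<le> (\<Sum>w\<in>F. ennreal (scale w powr t) * image_content T) + ennreal e"
    using packingsD(2)[OF F(1)]
    by (intro add_mono F(2) sum_mono mult_left_mono image_content_linear_part_le) auto
  also have "(\<Sum>w\<in>F. ennreal (scale w powr t) * image_content T) = image_content T * ennreal (weight F)"
    by (rule sum_scale_mult)
  also have "\<dots> \<le> image_content T * max_weight n V"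
    by (intro mult_left_mono max_weight_upper F(1)) simp
  finally show "hausdorff_content t (T ` V) \<le> image_content T * max_weight n V + ennreal e"
    by (simp add: add_right_mono)
qed

text \<open>Here the upper bound is applied to the complement of a packing of \<open>V\<close>: the
  complement accounts for at most its share of \<open>image_content T\<close>, so the image of
  \<open>V\<close> must provide the rest.\<close>

lemma max_weight_le_hausdorff_content_image:
  fixes T :: "'a \<Rightarrow>\<^sub>L 'b::euclidean_space"
  shows "image_content T * max_weight n V \<le> hausdorff_content t (T ` V)"
proof -
  let ?c = "image_content T"
  have "?c * ennreal (weight F) \<le> hausdorff_content t (T ` V)" if F: "F \<in> packings n V" for F
  proof -
    have FK: "F \<in> packings 0 K"
      using F packingsD[OF F] cyl_subset unfolding packings_def by blast
    define r where "r = ?c * max_weight 0 (K - cyls F)"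
    \<comment> \<open>Finiteness of \<open>r\<close> allows it to be cancelled at the end.\<close>
    have r_fin: "r < top"
      using image_content_less_top[of T] max_weight_le_1[of 0 "K - cyls F"]
      by (auto simp: r_def ennreal_mult_less_top intro: le_less_trans)
    have "?c * ennreal (weight F) + r = ?c * (ennreal (weight F) + max_weight 0 (K - cyls F))"
      by (simp add: r_def distrib_left)
    also have "\<dots> \<le> ?c * 1"
      using max_weight_superadditive[OF FK] max_weight_le_1[of 0 K]
      by (intro mult_left_mono) (auto intro: order_trans)
    also have "?c * 1 = hausdorff_content t (T ` K)"
      by (simp add: image_content_def)
    also have "\<dots> \<le> hausdorff_content t (T ` cyls F \<union> T ` (K - cyls F))"
      by (intro cover_content_mono) blast
    also have "\<dots> \<le> hausdorff_content t (T ` cyls F) + hausdorff_content t (T ` (K - cyls F))"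
      by (rule cover_content_Un_le) simp
    also have "\<dots> \<le> hausdorff_content t (T ` V) + r"
      unfolding r_def using packingsD[OF F]
      by (intro add_mono cover_content_mono image_mono hausdorff_content_image_le_max_weight
          openin_diff_cyls) auto
    finally show ?thesis
      using r_fin by (auto simp: add.commute[of _ r] ennreal_add_left_cancel_le)
  qed
  then show ?thesis
    unfolding max_weight_def SUP_mult_left_ennreal by (intro SUP_least)
qed

text \<open>\<open>V\<close> is filled by cylinders of diameter at most \<open>\<delta>\<close>. Any
  bounded cover of \<open>K\<close>, rescaled into such a cylinder, has mesh at most
  \<open>\<delta>\<close>, so the content of \<open>K\<close> already controls the
  premeasure.\<close>

lemma hausdorff_measure_le_content_mult_max_weight:
  assumes V: "openin (top_of_set K) V"
  shows "hausdorff_measure t V \<le> hausdorff_content t K * max_weight 0 V"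
proof (rule hausdorff_measure_leI, rule ennreal_le_epsilon)
  fix \<delta> e :: real
  assume "\<delta> > 0" "e > 0"
  have "\<delta> / diameter K > 0"
    using \<open>\<delta> > 0\<close> diameter_K_pos by simp
  then obtain n where n: "\<And>w. w \<in> words \<Longrightarrow> n \<le> length w \<Longrightarrow> scale w < \<delta> / diameter K"
    using scale_small by blast
  obtain F where F: "F \<in> packings n V" "hausdorff_measure t (V - cyls F) \<le> ennreal e"
    using exists_filling_packing[OF V \<open>e > 0\<close>] by blast
  let ?pre = "cover_content (\<lambda>U. bounded U \<and> diameter U \<le> \<delta>) t"
  have cyl: "?pre (cyl w) \<le> ennreal (scale w powr t) * hausdorff_content t K" if "w \<in> F" for w
  proof -
    have w: "w \<in> words" "n \<le> length w"
      using that F(1) by (auto simp: packings_def disjoint_cyls_def)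
    have "bounded (cyl w) \<and> diameter (cyl w) \<le> \<delta>"
    proof -
      have "diameter (cyl w) \<le> scale w * diameter K"
        using bounded_K scale_pos[OF w(1)] dist_word_map[OF w(1)] by (intro diameter_image_le) auto
      also have "\<dots> \<le> \<delta>"
        using n[OF w] diameter_K_pos by (simp add: field_simps)
      finally show ?thesis
        using compact_imp_bounded[OF compact_cyl[OF w(1)]] by simp
    qed
    \<comment> \<open>Each rescaled covering set lies inside the cylinder and inherits its diameter
      bound.\<close>
    then have small: "bounded (word_map w ` (U \<inter> K)) \<and> diameter (word_map w ` (U \<inter> K)) \<le> \<delta>" for U
      by (meson Int_lower2 bounded_subset diameter_subset image_mono order_trans)
    show ?thesis
      using dist_word_map[OF w(1)] scale_pos[OF w(1)] hausdorff_dim_pos small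
      by (intro cover_content_image_le) auto
  qed
  have "hausdorff_premeasure t \<delta> V \<le> ?pre (cyls F \<union> (V - cyls F))"
    unfolding hausdorff_premeasure_eq_cover_content by (intro cover_content_mono) blast
  also have "\<dots> \<le> ?pre (cyls F) + ?pre (V - cyls F)"
    using \<open>\<delta> > 0\<close> by (intro cover_content_Un_le) simp
  also have "\<dots> \<le> hausdorff_content t K * max_weight 0 V + ennreal e"
  proof (rule add_mono)
    have "?pre (cyls F) \<le> (\<Sum>w\<in>F. ?pre (cyl w))"
      using \<open>\<delta> > 0\<close> packingsD(1)[OF F(1)] by (intro cover_content_UN_finite_le) simp_all
    also have "\<dots> \<le> (\<Sum>w\<in>F. ennreal (scale w powr t) * hausdorff_content t K)"
      by (intro sum_mono cyl)
    also have "\<dots> = hausdorff_content t K * ennreal (weight F)"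
      by (rule sum_scale_mult)
    also have "\<dots> \<le> hausdorff_content t K * max_weight 0 V"
      using max_weight_upper[OF F(1)] max_weight_antimono[of 0 n V]
      by (intro mult_left_mono) (auto intro: order_trans)
    finally show "?pre (cyls F) \<le> hausdorff_content t K * max_weight 0 V" .
    have "?pre (V - cyls F) \<le> hausdorff_measure t (V - cyls F)"
      using hausdorff_premeasure_le_measure[OF \<open>\<delta> > 0\<close>, of t "V - cyls F"]
      by (simp add: hausdorff_premeasure_eq_cover_content)
    with F(2) show "?pre (V - cyls F) \<le> ennreal e"
      by (rule order_trans[rotated])
  qed
  finally show "hausdorff_premeasure t \<delta> V \<le> hausdorff_content t K * max_weight 0 V + ennreal e" .
qed

lemma image_content_id: "image_content (id_blinfun :: 'a \<Rightarrow>\<^sub>L 'a) = hausdorff_content t K"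
  by (simp add: image_content_def)

lemma openin_Int_UN: "(\<And>i. open (U i)) \<Longrightarrow> openin (top_of_set K) (K \<inter> (\<Union>i. U i))"
  by (intro openin_open_Int open_UN) auto

text \<open>On relatively open sets \<open>V\<close> the content of \<open>T ` V\<close> and the content of \<open>V\<close> are both
  proportional to \<^term>\<open>max_weight 0 V\<close>, and the content of \<open>V\<close> bounds its measure. The
  following bounds for arbitrary sets are multiplied by \<^term>\<open>hausdorff_content t K\<close>, which avoids a division.\<close>

lemma content_image_le:
  fixes T :: "'a \<Rightarrow>\<^sub>L 'b::euclidean_space"
  assumes X: "X \<subseteq> K"
  shows "hausdorff_content t K * hausdorff_content t (T ` X) \<le> image_content T * hausdorff_content t X"
proof (rule le_mult_ennrealI)
  fix a assume "hausdorff_content t X < a"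
  then obtain U where U: "X \<subseteq> (\<Union>i. U i)" "\<And>i. open (U i)" "\<And>i. bounded (U i)" "(\<Sum>i. diam_pow t (U i)) < a"
    using hausdorff_content_open_coverE hausdorff_dim_pos by blast
  \<comment> \<open>A relatively open set containing \<open>X\<close>, whose content is still at
    most \<open>a\<close>.\<close>
  define V where "V = K \<inter> (\<Union>i. U i)"
  have V: "openin (top_of_set K) V"
    unfolding V_def using U(2) by (rule openin_Int_UN)
  have "hausdorff_content t (T ` X) \<le> hausdorff_content t (T ` V)"
    using X U(1) by (intro cover_content_mono image_mono) (simp add: V_def)
  also have "\<dots> \<le> image_content T * max_weight 0 V"
    by (rule hausdorff_content_image_le_max_weight[OF V])
  finally have "hausdorff_content t K * hausdorff_content t (T ` X)
      \<le> hausdorff_content t K * (image_content T * max_weight 0 V)"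
    by (rule mult_left_mono) simp
  also have "\<dots> = image_content T * (hausdorff_content t K * max_weight 0 V)"
    by (rule mult.left_commute)
  also have "\<dots> \<le> image_content T * hausdorff_content t V"
    using max_weight_le_hausdorff_content_image[of "id_blinfun :: 'a \<Rightarrow>\<^sub>L 'a" 0 V]
    by (intro mult_left_mono) (simp_all add: image_content_id)
  also have "hausdorff_content t V \<le> (\<Sum>i. diam_pow t (U i))"
    using U(3) by (intro cover_content_le) (auto simp: V_def)
  also have "\<dots> \<le> a"
    using U(4) by simp
  finally show "hausdorff_content t K * hausdorff_content t (T ` X) \<le> image_content T * a"
    by (simp add: mult_left_mono)
qed (use X bounded_K in \<open>auto intro: image_content_less_top hausdorff_content_less_top bounded_subset\<close>)

text \<open>A near-optimal open cover of \<open>E\<close> is pulled back to a relatively open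
  \<open>V\<close>, whose image is covered by the same sets. The left side has measure instead of
  content so that Caratheodory additivity can be applied to it.\<close>

lemma measure_vimage_le:
  fixes T :: "'a \<Rightarrow>\<^sub>L 'b::euclidean_space"
  assumes E: "bounded E"
  shows "image_content T * hausdorff_measure t (K \<inter> T -` E) \<le> hausdorff_content t K * hausdorff_content t E"
proof (rule le_mult_ennrealI)
  fix a assume "hausdorff_content t E < a"
  then obtain U where U: "E \<subseteq> (\<Union>i. U i)" "\<And>i. open (U i)" "\<And>i. bounded (U i)" "(\<Sum>i. diam_pow t (U i)) < a"
    using hausdorff_content_open_coverE hausdorff_dim_pos by blast
  define V where "V = K \<inter> (\<Union>i. T -` U i)"
  have V: "openin (top_of_set K) V"
    unfolding V_def using U(2) by (intro openin_Int_UN open_vimage continuous_intros)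
  have "hausdorff_measure t (K \<inter> T -` E) \<le> hausdorff_measure t V"
    unfolding V_def vimage_UN[symmetric]
    using U(1) by (intro hausdorff_measure_mono Int_mono vimage_mono subset_refl)
  also have "\<dots> \<le> hausdorff_content t K * max_weight 0 V"
    by (rule hausdorff_measure_le_content_mult_max_weight[OF V])
  finally have "image_content T * hausdorff_measure t (K \<inter> T -` E)
      \<le> image_content T * (hausdorff_content t K * max_weight 0 V)"
    by (rule mult_left_mono) simp
  also have "\<dots> = hausdorff_content t K * (image_content T * max_weight 0 V)"
    by (rule mult.left_commute)
  also have "\<dots> \<le> hausdorff_content t K * hausdorff_content t (T ` V)"
    by (intro mult_left_mono max_weight_le_hausdorff_content_image) simp
  also have "hausdorff_content t (T ` V) \<le> (\<Sum>i. diam_pow t (U i))"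
    using U(3) by (intro cover_content_le) (auto simp: V_def)
  also have "\<dots> \<le> a"
    using U(4) by simp
  finally show "image_content T * hausdorff_measure t (K \<inter> T -` E) \<le> hausdorff_content t K * a"
    by (simp add: mult_left_mono)
qed (use E bounded_K in \<open>auto intro: hausdorff_content_less_top\<close>)

section \<open>Intersections of images\<close>

lemma hausdorff_measure_linear_image_eq_0:
  fixes T :: "'a \<Rightarrow>\<^sub>L 'b::euclidean_space"
  assumes "hausdorff_measure t X = 0"
  shows "hausdorff_measure t (T ` X) = 0"
proof (rule hausdorff_content_eq_0_imp_measure[OF _ hausdorff_dim_pos])
  have "hausdorff_content t X = 0"
    using assms hausdorff_content_le_measure[of t X] by simp
  then show "hausdorff_content t (T ` X) = 0"
    using hausdorff_content_linear_image_le[of T X] by simp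
qed

text \<open>Caratheodory's condition for \<open>A\<close>, tested on \<open>X \<union> Y\<close>;
  measurability of \<open>X\<close> and \<open>Y\<close> is not assumed.\<close>

lemma hausdorff_measurable_Un_disjoint:
  assumes "hausdorff_measurable t A" "X \<subseteq> A" "Y \<inter> A = {}"
  shows "hausdorff_measure t (X \<union> Y) = hausdorff_measure t X + hausdorff_measure t Y"
proof -
  have "hausdorff_measure t (A \<inter> (X \<union> Y)) + hausdorff_measure t ((UNIV - A) \<inter> (X \<union> Y))
      = hausdorff_measure t (X \<union> Y)"
    using assms(1) by (simp add: hausdorff_measurable_def lambda_system_def)
  moreover have "A \<inter> (X \<union> Y) = X" "(UNIV - A) \<inter> (X \<union> Y) = Y"
    using assms(2,3) by auto
  ultimately show ?thesis
    by simp
qed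

lemma image_Int_null_of_disjoint:
  fixes T :: "'a \<Rightarrow>\<^sub>L 'b::euclidean_space"
  assumes A: "A \<subseteq> K" "hausdorff_measurable t A" and B: "B \<subseteq> K" "B \<inter> A = {}"
  shows "hausdorff_content t (T ` A \<inter> T ` B) = 0"
proof -
  define E where "E = T ` A \<inter> T ` B"
  define h where "h = hausdorff_content t E"
  define c where "c = hausdorff_content t K"
  have "bounded (T ` K)"
    by (intro compact_imp_bounded compact_continuous_image compact_K continuous_intros)
  then have bE: "bounded E"
    by (rule bounded_subset) (use A(1) in \<open>auto simp: E_def\<close>)
  have fin: "h < top" "c < top"
    using bE bounded_K by (auto simp: h_def c_def intro: hausdorff_content_less_top)
  have "E \<subseteq> T ` A" "E \<subseteq> T ` B"
    by (simp_all add: E_def)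
  then have img: "T ` (A \<inter> T -` E) = E" "T ` (B \<inter> T -` E) = E"
    by blast+
  have le: "c * h \<le> image_content T * hausdorff_measure t X" if "X \<subseteq> K" "T ` X = E" for X
  proof -
    have "c * h \<le> image_content T * hausdorff_content t X"
      using content_image_le[OF that(1), of T] that(2) by (simp add: c_def h_def)
    also have "\<dots> \<le> image_content T * hausdorff_measure t X"
      by (intro mult_left_mono hausdorff_content_le_measure) simp
    finally show ?thesis .
  qed
  \<comment> \<open>The parts of \<open>A\<close> and \<open>B\<close> over \<open>E\<close> each
    have image \<open>E\<close>, and their measures add up inside the part of \<open>K\<close> over
    \<open>E\<close>. The chain ends at a single \<open>c * h\<close>, which is finite and hence
    0.\<close>
  have "c * h + c * h \<le> image_content T * hausdorff_measure t (A \<inter> T -` E)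
      + image_content T * hausdorff_measure t (B \<inter> T -` E)"
    using A(1) B(1) img by (intro add_mono le) auto
  also have "\<dots> = image_content T * hausdorff_measure t ((A \<inter> T -` E) \<union> (B \<inter> T -` E))"
    using B(2) by (subst hausdorff_measurable_Un_disjoint[OF A(2)]) (auto simp: distrib_left)
  also have "\<dots> \<le> image_content T * hausdorff_measure t (K \<inter> T -` E)"
    using A(1) B(1) by (intro mult_left_mono hausdorff_measure_mono) auto
  also have "\<dots> \<le> c * h"
    unfolding c_def h_def by (rule measure_vimage_le[OF bE])
  finally have "c * h + c * h \<le> c * h + 0"
    by simp
  moreover have "c * h \<noteq> \<infinity>"
    using fin by (auto simp: ennreal_mult_eq_top_iff)
  ultimately have "c * h = 0"
    unfolding ennreal_add_left_cancel_le by simp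
  \<comment> \<open>If the content of \<open>K\<close> vanishes, so does that of its Lipschitz
    image, which contains \<open>E\<close>.\<close>
  moreover have "h = 0" if "c = 0"
  proof -
    have "h \<le> image_content T"
      unfolding h_def image_content_def using A(1) by (intro cover_content_mono) (auto simp: E_def)
    also have "\<dots> \<le> ennreal ((norm T + 1) powr t) * c"
      unfolding image_content_def c_def by (rule hausdorff_content_linear_image_le)
    finally show ?thesis
      using that by simp
  qed
  ultimately show ?thesis
    by (auto simp: h_def E_def)
qed

end

theorem corollary1p4:
  fixes S :: "nat \<Rightarrow> 'a::euclidean_space \<Rightarrow> 'a"
    and m :: nat
    and K A B :: "'a set"
    and t :: real
    and L :: "'a \<Rightarrow> 'b::euclidean_space"
  assumes "ss_ifs m S"
    and "is_attractor m S K"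
    and "\<exists>x\<in>K. \<exists>y\<in>K. x \<noteq> y"
    and "t = hausdorff_dim K"
    and "linear L"
    and "A \<subseteq> K" and "B \<subseteq> K"
    and "hausdorff_measure t (A \<inter> B) = 0"
    and "hausdorff_measurable t A"
  shows "hausdorff_measure t (L ` A \<inter> L ` B) = 0"
proof -
  interpret ss_attractor S m K
    using assms(1-3) by unfold_locales
  define T where "T = Blinfun L"
  have L: "L = blinfun_apply T"
    using assms(5) by (simp add: T_def bounded_linear_Blinfun_apply linear_conv_bounded_linear)
  \<comment> \<open>Removing \<open>A\<close> from \<open>B\<close> gives disjoint sets; the removed
    part \<open>A \<inter> B\<close> is null and so is its image.\<close>
  have "hausdorff_content t (L ` A \<inter> L ` (B - A)) = 0"
    using assms(4,6,7,9) unfolding L by (auto intro!: image_Int_null_of_disjoint)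
  moreover have "hausdorff_measure t (L ` (A \<inter> B)) = 0"
    using assms(4,8) unfolding L by (auto intro: hausdorff_measure_linear_image_eq_0)
  then have "hausdorff_content t (L ` (A \<inter> B)) = 0"
    using hausdorff_content_le_measure[of t "L ` (A \<inter> B)"] by simp
  moreover have "hausdorff_content t (L ` A \<inter> L ` B)
      \<le> hausdorff_content t ((L ` A \<inter> L ` (B - A)) \<union> L ` (A \<inter> B))"
    by (intro cover_content_mono) blast
  moreover have "\<dots> \<le> hausdorff_content t (L ` A \<inter> L ` (B - A)) + hausdorff_content t (L ` (A \<inter> B))"
    by (rule cover_content_Un_le) simp
  ultimately have "hausdorff_content t (L ` A \<inter> L ` B) = 0"
    by simp
  then show ?thesis
    using hausdorff_dim_pos assms(4) by (simp add: hausdorff_content_eq_0_imp_measure)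
qed

end
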